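(* Let $W$ be a Coxeter group of type $E_n$ with $n\in\{6,7,8\}$, and let $E_n(a_i)$ be an oriented Carter diagram, i.e. one of the orientable Carter diagrams $$E_6(a_1),\ E_6(a_2),\ E_7(a_1),\ E_7(a_2),\ E_7(a_3),\ E_8(a_1),\dots,E_8(a_6)$$ of type $E_n$, with its edges oriented in such a way that each 4-cycle is an oriented cycle. Then the Artin group $A(E_n)$ associated with $W$ admits a presentation over generators corresponding to the vertices of $E_n(a_i)$, with relations $R(E_n(a_i))$ together with a set of cycle commutator relators $$\mathrm{cc}(\boldsymbol{s}_1,\boldsymbol{s}_2,\boldsymbol{s}_3,\boldsymbol{s}_4)=[\boldsymbol{s}_1,\ \boldsymbol{s}_2\boldsymbol{s}_3\boldsymbol{s}_4\boldsymbol{s}_3^{-1}\boldsymbol{s}_2^{-1}],$$ one corresponding to each oriented 4-cycle $s_1\to s_2\to s_3\to s_4\to s_1$ in the diagram.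
   Context: The diagrams (all edges simple): $E_6(a_1)$ has vertices $b_0,b_1,b_2,c_0,c_1,c_2$ and edges $b_0b_1,\ b_1b_2,\ c_0c_1,\ c_1c_2,\ b_0c_0,\ b_1c_1$; $E_6(a_2)$ is $E_6(a_1)$ with the extra edge $b_2c_2$. $E_7(a_1)$ is $E_6(a_1)$ plus a vertex $c_3$ and edge $c_2c_3$; $E_7(a_2)$ is $E_6(a_1)$ plus a vertex $c_{-1}$ and edge $c_{-1}c_0$; $E_7(a_3)$ is $E_6(a_2)$ plus a vertex $c_3$ and edge $c_2c_3$. $E_8(a_1)$ is $E_6(a_1)$ plus vertices $c_3,c_4$ and edges $c_2c_3,\ c_3c_4$; $E_8(a_2)$ is $E_6(a_1)$ plus $c_3,b_{-1}$ and edges $c_2c_3,\ b_{-1}b_0$; $E_8(a_3)$ is $E_6(a_1)$ plus $c_{-1},b_{-1}$ and edges $c_{-1}c_0,\ b_{-1}b_0$; $E_8(a_4)$ is $E_6(a_2)$ plus $c_3,c_4$ and edges $c_2c_3,\ c_3c_4$; $E_8(a_5)$ is $E_6(a_2)$ plus $c_3,b_{-1}$ and edges $c_2c_3,\ b_{-1}b_0$; $E_8(a_6)$ is $E_6(a_2)$ plus $c_3,b_3$ and edges $c_2c_3,\ b_2b_3,\ b_3c_3$. For a diagram $\Delta$ with simple edges, $R(\Delta)$ is the set of braid relations: $\boldsymbol{s}\boldsymbol{t}\boldsymbol{s}=\boldsymbol{t}\boldsymbol{s}\boldsymbol{t}$ if the vertices $s,t$ are joined by an edge, $\boldsymbol{s}\boldsymbol{t}=\boldsymbol{t}\boldsymbol{s}$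 if not. $A(E_n)$ is the Artin group of the Coxeter diagram $E_n$. $[a,b]$ is the commutator. For a given oriented 4-cycle the four cycle commutators obtained by cyclically rotating $(\boldsymbol{s}_1,\boldsymbol{s}_2,\boldsymbol{s}_3,\boldsymbol{s}_4)$ are equivalent modulo the braid relations, so the starting vertex is immaterial. *)

theory Defs
  imports "HOL-Algebra.Group"
begin

section \<open>Group presentations\<close>

text \<open>A word over a set S of generators is a list of letters; the letter (x, True) stands for the
  generator x and (x, False) for its formal inverse.\<close>

type_synonym 'a word = "('a \<times> bool) list"

definition words :: "'a set \<Rightarrow> 'a word set" where
  "words S = lists (S \<times> UNIV)"

definition gen :: "'a \<Rightarrow> 'a word" where
  "gen x = [(x, True)]"

definition winv :: "'a word \<Rightarrow> 'a word" where
  "winv w = rev (map (\<lambda>(x, e). (x, \<not> e)) w)"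

text \<open>A pair (l, r) in R is the relation l = r; a relator w is the pair (w, []).
  Free cancellation is built in, so the quotient of the word monoid by this congruence is the
  quotient of the free group on S by the normal closure of the words l @ winv r.\<close>

inductive_set pres_cong :: "'a set \<Rightarrow> ('a word \<times> 'a word) set \<Rightarrow> ('a word \<times> 'a word) set"
  for S :: "'a set" and R :: "('a word \<times> 'a word) set" where
  refl: "w \<in> words S \<Longrightarrow> (w, w) \<in> pres_cong S R"
| sym: "(v, w) \<in> pres_cong S R \<Longrightarrow> (w, v) \<in> pres_cong S R"
| trans: "(u, v) \<in> pres_cong S R \<Longrightarrow> (v, w) \<in> pres_cong S R \<Longrightarrow> (u, w) \<in> pres_cong S R"
| cancel: "u \<in> words S \<Longrightarrow> v \<in> words S \<Longrightarrow> x \<in> S \<Longrightarrow>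
    (u @ [(x, e), (x, \<not> e)] @ v, u @ v) \<in> pres_cong S R"
| relation: "u \<in> words S \<Longrightarrow> v \<in> words S \<Longrightarrow> (l, r) \<in> R \<Longrightarrow> l \<in> words S \<Longrightarrow> r \<in> words S \<Longrightarrow>
    (u @ l @ v, u @ r @ v) \<in> pres_cong S R"

definition presented_group :: "'a set \<Rightarrow> ('a word \<times> 'a word) set \<Rightarrow> 'a word set monoid" where
  "presented_group S R =
    \<lparr> carrier = words S // pres_cong S R,
      mult = (\<lambda>X Y. \<Union>x\<in>X. \<Union>y\<in>Y. pres_cong S R `` {x @ y}),
      one = pres_cong S R `` {[]} \<rparr>"

section \<open>Simply laced diagrams and Artin groups\<close>

record 'v diagram =
  verts :: "'v set"
  edges :: "'v set set"

definition braid_relations :: "'v diagram \<Rightarrow> ('v word \<times> 'v word) set" where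
  "braid_relations D =
     {(gen s @ gen t @ gen s, gen t @ gen s @ gen t) | s t.
        s \<in> verts D \<and> t \<in> verts D \<and> {s, t} \<in> edges D} \<union>
     {(gen s @ gen t, gen t @ gen s) | s t.
        s \<in> verts D \<and> t \<in> verts D \<and> s \<noteq> t \<and> {s, t} \<notin> edges D}"

definition artin_group :: "'v diagram \<Rightarrow> 'v word set monoid" where
  "artin_group D = presented_group (verts D) (braid_relations D)"

text \<open>The Coxeter diagram of type E in Bourbaki's labelling (meant for n = 6, 7, 8): the path
  1 - 3 - 4 - ... - n, with the vertex 2 attached to 4.\<close>

definition coxeter_E :: "nat \<Rightarrow> nat diagram" where
  "coxeter_E n =
    \<lparr> verts = {1..n},
      edges = {{1, 3}, {2, 4}} \<union> {{k, k + 1} | k. 3 \<le> k \<and> k < n} \<rparr>"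

section \<open>The orientable Carter diagrams of type E\<close>

datatype vertex = B int | C int

definition extend :: "'v diagram \<Rightarrow> 'v set \<Rightarrow> 'v set set \<Rightarrow> 'v diagram" where
  "extend D V E = \<lparr> verts = verts D \<union> V, edges = edges D \<union> E \<rparr>"

definition E6_a1 :: "vertex diagram" where
  "E6_a1 =
    \<lparr> verts = {B 0, B 1, B 2, C 0, C 1, C 2},
      edges = {{B 0, B 1}, {B 1, B 2}, {C 0, C 1}, {C 1, C 2}, {B 0, C 0}, {B 1, C 1}} \<rparr>"

definition E6_a2 :: "vertex diagram" where
  "E6_a2 = extend E6_a1 {} {{B 2, C 2}}"

definition E7_a1 :: "vertex diagram" where
  "E7_a1 = extend E6_a1 {C 3} {{C 2, C 3}}"

definition E7_a2 :: "vertex diagram" where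
  "E7_a2 = extend E6_a1 {C (-1)} {{C (-1), C 0}}"

definition E7_a3 :: "vertex diagram" where
  "E7_a3 = extend E6_a2 {C 3} {{C 2, C 3}}"

definition E8_a1 :: "vertex diagram" where
  "E8_a1 = extend E6_a1 {C 3, C 4} {{C 2, C 3}, {C 3, C 4}}"

definition E8_a2 :: "vertex diagram" where
  "E8_a2 = extend E6_a1 {C 3, B (-1)} {{C 2, C 3}, {B (-1), B 0}}"

definition E8_a3 :: "vertex diagram" where
  "E8_a3 = extend E6_a1 {C (-1), B (-1)} {{C (-1), C 0}, {B (-1), B 0}}"

definition E8_a4 :: "vertex diagram" where
  "E8_a4 = extend E6_a2 {C 3, C 4} {{C 2, C 3}, {C 3, C 4}}"

definition E8_a5 :: "vertex diagram" where
  "E8_a5 = extend E6_a2 {C 3, B (-1)} {{C 2, C 3}, {B (-1), B 0}}"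

definition E8_a6 :: "vertex diagram" where
  "E8_a6 = extend E6_a2 {C 3, B 3} {{C 2, C 3}, {B 2, B 3}, {B 3, C 3}}"

definition carter_E :: "nat \<Rightarrow> vertex diagram set" where
  "carter_E n =
    (if n = 6 then {E6_a1, E6_a2}
     else if n = 7 then {E7_a1, E7_a2, E7_a3}
     else if n = 8 then {E8_a1, E8_a2, E8_a3, E8_a4, E8_a5, E8_a6}
     else {})"

section \<open>Orientations and cycle commutators\<close>

text \<open>An orientation is a set of ordered pairs (u, v), read as arrows from u to v.\<close>

definition is_orientation :: "'v diagram \<Rightarrow> ('v \<times> 'v) set \<Rightarrow> bool" where
  "is_orientation D A \<longleftrightarrow>
     (\<forall>(u, v) \<in> A. {u, v} \<in> edges D) \<and>
     (\<forall>u v. {u, v} \<in> edges D \<longrightarrow> ((u, v) \<in> A \<longleftrightarrow> (v, u) \<notin> A))"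

type_synonym 'v quad = "'v \<times> 'v \<times> 'v \<times> 'v"

definition four_cycles :: "'v diagram \<Rightarrow> 'v quad set" where
  "four_cycles D = {(s1, s2, s3, s4). distinct [s1, s2, s3, s4] \<and>
     {s1, s2} \<in> edges D \<and> {s2, s3} \<in> edges D \<and> {s3, s4} \<in> edges D \<and> {s4, s1} \<in> edges D}"

definition oriented_four_cycles :: "('v \<times> 'v) set \<Rightarrow> 'v quad set" where
  "oriented_four_cycles A = {(s1, s2, s3, s4). distinct [s1, s2, s3, s4] \<and>
     (s1, s2) \<in> A \<and> (s2, s3) \<in> A \<and> (s3, s4) \<in> A \<and> (s4, s1) \<in> A}"

definition four_cycles_oriented :: "'v diagram \<Rightarrow> ('v \<times> 'v) set \<Rightarrow> bool" where
  "four_cycles_oriented D A \<longleftrightarrow> (\<forall>(s1, s2, s3, s4) \<in> four_cycles D.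
     (s1, s2, s3, s4) \<in> oriented_four_cycles A \<or> (s4, s3, s2, s1) \<in> oriented_four_cycles A)"

definition rotations :: "'v quad \<Rightarrow> 'v quad set" where
  "rotations = (\<lambda>(s1, s2, s3, s4).
     {(s1, s2, s3, s4), (s2, s3, s4, s1), (s3, s4, s1, s2), (s4, s1, s2, s3)})"

text \<open>An oriented 4-cycle is a quadruple up to rotation; T selects one starting vertex for each.\<close>

definition is_cycle_transversal :: "('v \<times> 'v) set \<Rightarrow> 'v quad set \<Rightarrow> bool" where
  "is_cycle_transversal A T \<longleftrightarrow> T \<subseteq> oriented_four_cycles A \<and>
     (\<forall>q \<in> oriented_four_cycles A. \<exists>!t. t \<in> T \<and> t \<in> rotations q)"

definition commutator :: "'a word \<Rightarrow> 'a word \<Rightarrow> 'a word" where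
  "commutator v w = v @ w @ winv v @ winv w"

definition cc :: "'v quad \<Rightarrow> 'v word" where
  "cc = (\<lambda>(s1, s2, s3, s4). commutator (gen s1)
     (gen s2 @ gen s3 @ gen s4 @ winv (gen s3) @ winv (gen s2)))"

definition cc_relations :: "'v quad set \<Rightarrow> ('v word \<times> 'v word) set" where
  "cc_relations T = {(cc q, []) | q. q \<in> T}"

end

theory Submission imports Defs
begin

text \<open>Everything rests on one change of generators, called a switch below. Let p - q - r be a path
  in a diagram and let v be a vertex joined to q but not to p or r. Replace the generator v by its
  conjugate t = (qprq) v (qprq)^-1. Then t still braids with q and commutes with p and r, and
  vertices away from the path are related to t as they were to v. A vertex x joined to exactly one
  end of the path, say to p, and not to q, changes its behaviour: x commutes with t if and only if
  the cycle commutator of the square x \<rightarrow> p \<rightarrow> q \<rightarrow> v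
  \<rightarrow> x is trivial (lemma \<open>rel_switched_end_neighbour\<close>), and if x commutes
  with v, then x braids with t and the cycle commutator of t \<rightarrow> q \<rightarrow> p
  \<rightarrow> x \<rightarrow> t is trivial. So a switch turns the presentation given by the
  braid relations of a diagram and the cycle commutators of its squares into the presentation of
  the same kind for the diagram in which all edges xv, for x a neighbour of an end of the path,
  have been toggled: a square through x and v becomes a non-edge, a non-edge becomes a square.
  This is \<open>square_group_switch\<close>.

  Switching C 1 along B 0 - B 1 - B 2 opens all squares of E6(a1), E6(a2), E7(a1), E7(a2), E7(a3),
  E8(a1) and E8(a4), and what is left is the Coxeter diagram. The same switch takes E8(a3),
  E8(a5), E8(a6) to E8(a2), E8(a1), E8(a4) with the vertices renamed, and E8(a2) becomes E8 by
  switching B 1 along C 0 - B 0 - B (-1).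

  Two remarks reduce the theorem to these eleven diagrams, each with one fixed orientation. First,
  modulo the braid relations a cycle commutator may be rotated
  (\<open>cycle_commutes_rotate\<close>), so the transversal is immaterial. Secondly, inverting
  all generators preserves the braid relations and reverses the direction of every cycle
  commutator (\<open>cycle_commutes_inv\<close>); since squares that share an edge determine each
  other's direction, an admissible orientation is the fixed one or its reverse on all squares.
  That the four-cycles of a Carter diagram are the expected ones holds because all these diagrams
  are subgraphs of an infinite ladder.

  Isomorphisms are produced by Tietze transformations in the form of
  \<open>presented_group_iso\<close>: translate the generators into words both ways and check, in
  an arbitrary group, that a family of elements satisfying one set of relations is translated into
  a family satisfying the other.\<close>

section \<open>Presented groups and their universal property\<close>

lemma words_simps [simp]:
  "[] \<in> words S"
  "a # w \<in> words S \<longleftrightarrow> fst a \<in> S \<and> w \<in> words S"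
  "u @ v \<in> words S \<longleftrightarrow> u \<in> words S \<and> v \<in> words S"
  "gen x \<in> words S \<longleftrightarrow> x \<in> S"
  by (auto simp: words_def gen_def mem_Times_iff)

lemma winv_simps [simp]:
  "winv [] = []"
  "winv ((x, e) # w) = winv w @ [(x, \<not> e)]"
  "winv (u @ v) = winv v @ winv u"
  by (auto simp: winv_def)

lemma winv_in_words [simp]: "winv w \<in> words S \<longleftrightarrow> w \<in> words S"
  by (induction w) (auto simp: winv_def)

lemma pres_cong_words:
  assumes "(u, v) \<in> pres_cong S R"
  shows "u \<in> words S" "v \<in> words S"
  using assms by (induction, auto)

lemma equiv_pres_cong: "equiv (words S) (pres_cong S R)"
proof (rule equivI)
  show "pres_cong S R \<subseteq> words S \<times> words S"
    using pres_cong_words by fastforce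
qed (auto simp: refl_on_def sym_def trans_def
    intro: pres_cong.refl pres_cong.sym pres_cong.trans)

lemma pres_cong_context:
  assumes "(u, v) \<in> pres_cong S R" "x \<in> words S" "y \<in> words S"
  shows "(x @ u @ y, x @ v @ y) \<in> pres_cong S R"
  using assms
proof (induction)
  case (refl w)
  then show ?case by (auto intro: pres_cong.refl)
next
  case (sym v w)
  then show ?case by (auto intro: pres_cong.sym)
next
  case (trans u v w)
  then show ?case by (meson pres_cong.trans)
next
  case (cancel u v a e)
  then show ?case
    using pres_cong.cancel[of "x @ u" S "v @ y" a e R] by simp
next
  case (relation u v l r)
  then show ?case
    using pres_cong.relation[of "x @ u" S "v @ y" l r R] by simp
qed

lemma pres_cong_append:
  assumes "(u, u') \<in> pres_cong S R" "(v, v') \<in> pres_cong S R"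
  shows "(u @ v, u' @ v') \<in> pres_cong S R"
proof -
  have "(u @ v, u' @ v) \<in> pres_cong S R"
    using pres_cong_context[OF assms(1), of "[]" v] pres_cong_words[OF assms(2)] by simp
  moreover have "(u' @ v, u' @ v') \<in> pres_cong S R"
    using pres_cong_context[OF assms(2), of u' "[]"] pres_cong_words[OF assms(1)] by simp
  ultimately show ?thesis by (rule pres_cong.trans)
qed

lemma pres_cong_winv: "w \<in> words S \<Longrightarrow> (winv w @ w, []) \<in> pres_cong S R"
proof (induction w)
  case Nil
  then show ?case by (auto intro: pres_cong.refl)
next
  case (Cons a w)
  obtain x e where a: "a = (x, e)" by fastforce
  have "(winv w @ [(x, \<not> e), (x, \<not> \<not> e)] @ w, winv w @ w) \<in> pres_cong S R"
    using Cons a by (intro pres_cong.cancel) auto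
  with Cons a show ?case by (auto intro: pres_cong.trans)
qed

definition word_class :: "'a set \<Rightarrow> ('a word \<times> 'a word) set \<Rightarrow> 'a word \<Rightarrow> 'a word set" where
  "word_class S R w = pres_cong S R `` {w}"

lemma word_class_eq_iff:
  assumes "u \<in> words S" "v \<in> words S"
  shows "word_class S R u = word_class S R v \<longleftrightarrow> (u, v) \<in> pres_cong S R"
  unfolding word_class_def using assms by (simp add: eq_equiv_class_iff[OF equiv_pres_cong])

lemma carrier_presented_group: "carrier (presented_group S R) = word_class S R ` words S"
  by (auto simp: presented_group_def quotient_def word_class_def)

lemma one_presented_group: "\<one>\<^bsub>presented_group S R\<^esub> = word_class S R []"
  by (simp add: presented_group_def word_class_def)

lemma mult_presented_group:
  assumes "u \<in> words S" "v \<in> words S"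
  shows "word_class S R u \<otimes>\<^bsub>presented_group S R\<^esub> word_class S R v = word_class S R (u @ v)"
proof -
  have *: "word_class S R (x @ y) = word_class S R (u @ v)"
    if "x \<in> word_class S R u" "y \<in> word_class S R v" for x y
  proof -
    have "(u @ v, x @ y) \<in> pres_cong S R"
      using that by (auto simp: word_class_def intro: pres_cong_append)
    then show ?thesis
      using word_class_eq_iff pres_cong_words pres_cong.sym by metis
  qed
  have "u \<in> word_class S R u" "v \<in> word_class S R v"
    using assms by (auto simp: word_class_def intro: pres_cong.refl)
  then have "(\<Union>x\<in>word_class S R u. \<Union>y\<in>word_class S R v. word_class S R (x @ y))
      = word_class S R (u @ v)"
    using * by blast
  then show ?thesis
    by (simp add: presented_group_def word_class_def)
qed

lemma group_presented_group: "group (presented_group S R)"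
proof (rule groupI)
  fix x assume "x \<in> carrier (presented_group S R)"
  then obtain u where u: "u \<in> words S" "x = word_class S R u"
    by (auto simp: carrier_presented_group)
  then have "word_class S R (winv u) \<otimes>\<^bsub>presented_group S R\<^esub> x = \<one>\<^bsub>presented_group S R\<^esub>"
    using pres_cong_winv[OF u(1), of R]
    by (simp add: mult_presented_group one_presented_group word_class_eq_iff)
  then show "\<exists>y\<in>carrier (presented_group S R). y \<otimes>\<^bsub>presented_group S R\<^esub> x = \<one>\<^bsub>presented_group S R\<^esub>"
    using u by (auto simp: carrier_presented_group)
qed (auto simp: carrier_presented_group mult_presented_group one_presented_group)

definition eval :: "('g, 'm) monoid_scheme \<Rightarrow> ('a \<Rightarrow> 'g) \<Rightarrow> 'a word \<Rightarrow> 'g" where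
  "eval G \<phi> w = foldr (\<lambda>(x, e) g. (if e then \<phi> x else inv\<^bsub>G\<^esub> \<phi> x) \<otimes>\<^bsub>G\<^esub> g) w \<one>\<^bsub>G\<^esub>"

lemma eval_simps [simp]:
  "eval G \<phi> [] = \<one>\<^bsub>G\<^esub>"
  "eval G \<phi> ((x, e) # w) = (if e then \<phi> x else inv\<^bsub>G\<^esub> \<phi> x) \<otimes>\<^bsub>G\<^esub> eval G \<phi> w"
  by (simp_all add: eval_def)

context group
begin

lemma eval_closed [simp]:
  "\<phi> \<in> S \<rightarrow> carrier G \<Longrightarrow> w \<in> words S \<Longrightarrow> eval G \<phi> w \<in> carrier G"
  by (induction w) (auto simp: Pi_iff)

lemma eval_append:
  "\<phi> \<in> S \<rightarrow> carrier G \<Longrightarrow> u \<in> words S \<Longrightarrow> v \<in> words S \<Longrightarrow>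
    eval G \<phi> (u @ v) = eval G \<phi> u \<otimes> eval G \<phi> v"
proof (induction u)
  case (Cons a u)
  then have "\<phi> (fst a) \<in> carrier G" by auto
  with Cons show ?case by (cases a) (auto simp: m_assoc)
qed simp

lemma eval_gen: "\<phi> x \<in> carrier G \<Longrightarrow> eval G \<phi> (gen x) = \<phi> x"
  by (simp add: gen_def)

lemma eval_winv:
  "\<phi> \<in> S \<rightarrow> carrier G \<Longrightarrow> w \<in> words S \<Longrightarrow> eval G \<phi> (winv w) = inv (eval G \<phi> w)"
proof (induction w)
  case (Cons a w)
  obtain x e where a: "a = (x, e)" by fastforce
  have "\<phi> x \<in> carrier G" using Cons a by auto
  then show ?case
    using Cons a by (auto simp: eval_append[of \<phi> S] inv_mult_group)
qed simp

end

text \<open>An assignment of the generators satisfying the relations is the same thing as a homomorphism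
  from the presented group.\<close>

definition satisfies ::
    "('g, 'm) monoid_scheme \<Rightarrow> ('a \<Rightarrow> 'g) \<Rightarrow> 'a set \<Rightarrow> ('a word \<times> 'a word) set \<Rightarrow> bool" where
  "satisfies G \<phi> S R \<longleftrightarrow> \<phi> \<in> S \<rightarrow> carrier G \<and>
     (\<forall>(l, r) \<in> R. l \<in> words S \<longrightarrow> r \<in> words S \<longrightarrow> eval G \<phi> l = eval G \<phi> r)"

lemma (in group) eval_pres_cong:
  assumes "satisfies G \<phi> S R" "(u, v) \<in> pres_cong S R"
  shows "eval G \<phi> u = eval G \<phi> v"
  using assms(2)
proof induction
  case (cancel u v x e)
  have c: "\<phi> \<in> S \<rightarrow> carrier G" using assms(1) by (simp add: satisfies_def)
  then have "\<phi> x \<in> carrier G" using cancel by auto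
  then have "eval G \<phi> ([(x, e), (x, \<not> e)] @ v) = eval G \<phi> v"
    using cancel c by (auto simp: m_assoc[symmetric])
  then show ?case
    using cancel c by (simp add: eval_append[OF c, of u] del: append.simps eval_simps)
next
  case (relation u v l r)
  have c: "\<phi> \<in> S \<rightarrow> carrier G" using assms(1) by (simp add: satisfies_def)
  have "eval G \<phi> l = eval G \<phi> r"
    using assms(1) relation by (auto simp: satisfies_def)
  then show ?case
    using relation c by (simp add: eval_append[OF c])
qed auto

abbreviation gen_class :: "'a set \<Rightarrow> ('a word \<times> 'a word) set \<Rightarrow> 'a \<Rightarrow> 'a word set" where
  "gen_class S R x \<equiv> word_class S R (gen x)"

lemma eval_gen_class:
  "w \<in> words S \<Longrightarrow> eval (presented_group S R) (gen_class S R) w = word_class S R w"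
proof (induction w)
  case Nil
  then show ?case by (simp add: one_presented_group)
next
  case (Cons a w)
  interpret group "presented_group S R" by (rule group_presented_group)
  obtain x e where a: "a = (x, e)" by fastforce
  have x: "x \<in> S" using Cons a by auto
  have "word_class S R [(x, False)] \<otimes>\<^bsub>presented_group S R\<^esub> gen_class S R x = \<one>\<^bsub>presented_group S R\<^esub>"
    using pres_cong_winv[of "gen x" S R] x
    by (simp add: mult_presented_group one_presented_group word_class_eq_iff gen_def)
  then have "inv\<^bsub>presented_group S R\<^esub> (gen_class S R x) = word_class S R [(x, False)]"
    using x by (intro inv_equality) (auto simp: carrier_presented_group)
  then show ?case
    using Cons x a by (auto simp: mult_presented_group gen_def)
qed

lemma satisfies_gen_class: "satisfies (presented_group S R) (gen_class S R) S R"
  unfolding satisfies_def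
proof (intro conjI ballI)
  show "gen_class S R \<in> S \<rightarrow> carrier (presented_group S R)"
    by (auto simp: carrier_presented_group)
  fix z assume "z \<in> R"
  moreover obtain l r where "z = (l, r)" by fastforce
  ultimately show "case z of (l, r) \<Rightarrow> l \<in> words S \<longrightarrow> r \<in> words S \<longrightarrow>
      eval (presented_group S R) (gen_class S R) l = eval (presented_group S R) (gen_class S R) r"
    using pres_cong.relation[of "[]" S "[]" l r R]
    by (auto simp: eval_gen_class word_class_eq_iff)
qed

lemma universal_property:
  assumes "group G" "satisfies G \<phi> S R"
  obtains h where "h \<in> hom (presented_group S R) G"
    and "\<And>w. w \<in> words S \<Longrightarrow> h (word_class S R w) = eval G \<phi> w"
proof -
  interpret G: group G by fact
  define h where "h X = eval G \<phi> (SOME w. w \<in> X)" for X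
  have h: "h (word_class S R w) = eval G \<phi> w" if "w \<in> words S" for w
  proof -
    have "w \<in> word_class S R w"
      using that by (auto simp: word_class_def intro: pres_cong.refl)
    then have "(SOME w'. w' \<in> word_class S R w) \<in> word_class S R w" by (rule someI)
    then show ?thesis
      using G.eval_pres_cong[OF assms(2)] unfolding h_def word_class_def by fastforce
  qed
  have "\<phi> \<in> S \<rightarrow> carrier G" using assms(2) by (simp add: satisfies_def)
  then have "h \<in> hom (presented_group S R) G"
    by (auto simp: hom_def carrier_presented_group mult_presented_group h G.eval_append)
  with h that show ?thesis by blast
qed

lemma hom_eval:
  assumes "group G" "group H" "h \<in> hom G H" "\<phi> \<in> S \<rightarrow> carrier G" "w \<in> words S"
  shows "h (eval G \<phi> w) = eval H (\<lambda>x. h (\<phi> x)) w"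
proof -
  interpret h: group_hom G H h
    using assms by (simp add: group_hom_def group_hom_axioms_def)
  show ?thesis
    using assms(5)
  proof (induction w)
    case (Cons a w)
    then have "\<phi> (fst a) \<in> carrier G" using assms(4) by auto
    with Cons assms(4) show ?case by (cases a) auto
  qed simp
qed

lemma eval_cong: "w \<in> words S \<Longrightarrow> (\<And>x. x \<in> S \<Longrightarrow> \<phi> x = \<psi> x) \<Longrightarrow> eval G \<phi> w = eval G \<psi> w"
  by (induction w) auto

text \<open>The maps on generators are only tested on families of elements of arbitrary groups; this
  moves every computation with relations from words into a group. The universal property yields
  the two homomorphisms, and the last two hypotheses say that they are mutually inverse on
  generators.\<close>

proposition presented_group_iso:
  fixes S :: "'a set" and S' :: "'b set"
  assumes f: "\<And>x. x \<in> S \<Longrightarrow> f x \<in> words S'" and g: "\<And>y. y \<in> S' \<Longrightarrow> g y \<in> words S"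
    and fwd: "\<And>(G :: 'b word set monoid) \<phi>. group G \<Longrightarrow> satisfies G \<phi> S' R' \<Longrightarrow>
      satisfies G (\<lambda>x. eval G \<phi> (f x)) S R"
    and bwd: "\<And>(G :: 'a word set monoid) \<phi>. group G \<Longrightarrow> satisfies G \<phi> S R \<Longrightarrow>
      satisfies G (\<lambda>y. eval G \<phi> (g y)) S' R'"
    and gf: "\<And>(G :: 'a word set monoid) \<phi> x. group G \<Longrightarrow> \<phi> \<in> S \<rightarrow> carrier G \<Longrightarrow> x \<in> S \<Longrightarrow>
      eval G (\<lambda>y. eval G \<phi> (g y)) (f x) = \<phi> x"
    and fg: "\<And>(G :: 'b word set monoid) \<phi> y. group G \<Longrightarrow> \<phi> \<in> S' \<rightarrow> carrier G \<Longrightarrow> y \<in> S' \<Longrightarrow>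
      eval G (\<lambda>x. eval G \<phi> (f x)) (g y) = \<phi> y"
  shows "presented_group S R \<cong> presented_group S' R'"
proof -
  let ?P = "presented_group S R" and ?P' = "presented_group S' R'"
  let ?c = "gen_class S R" and ?c' = "gen_class S' R'"
  note grp = group_presented_group[of S R] and grp' = group_presented_group[of S' R']
  have c: "?c \<in> S \<rightarrow> carrier ?P" and c': "?c' \<in> S' \<rightarrow> carrier ?P'"
    by (auto simp: carrier_presented_group)
  obtain h where h: "h \<in> hom ?P ?P'"
    and hw: "\<And>w. w \<in> words S \<Longrightarrow> h (word_class S R w) = eval ?P' (\<lambda>x. eval ?P' ?c' (f x)) w"
    using universal_property[OF grp' fwd[OF grp' satisfies_gen_class]] by blast
  obtain k where k: "k \<in> hom ?P' ?P"
    and kw: "\<And>w. w \<in> words S' \<Longrightarrow> k (word_class S' R' w) = eval ?P (\<lambda>y. eval ?P ?c (g y)) w"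
    using universal_property[OF grp bwd[OF grp satisfies_gen_class]] by blast
  have ec': "(\<lambda>x. eval ?P' ?c' (f x)) \<in> S \<rightarrow> carrier ?P'"
    using f c' group.eval_closed[OF grp'] by blast
  have ec: "(\<lambda>y. eval ?P ?c (g y)) \<in> S' \<rightarrow> carrier ?P"
    using g c group.eval_closed[OF grp] by blast
  have "k (h X) = X" if "X \<in> carrier ?P" for X
  proof -
    obtain w where w: "w \<in> words S" "X = word_class S R w"
      using \<open>X \<in> carrier ?P\<close> by (auto simp: carrier_presented_group)
    have gens: "k (eval ?P' ?c' (f x)) = ?c x" if "x \<in> S" for x
      using that kw[of "f x"] gf[OF grp c] f by (simp add: eval_gen_class)
    have "k (h X) = eval ?P (\<lambda>x. k (eval ?P' ?c' (f x))) w"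
      using w hw hom_eval[OF grp' grp k ec' w(1)] by simp
    also have "\<dots> = eval ?P ?c w"
      using w gens by (intro eval_cong) auto
    finally show ?thesis using w by (simp add: eval_gen_class)
  qed
  moreover have "h (k X) = X" if "X \<in> carrier ?P'" for X
  proof -
    obtain w where w: "w \<in> words S'" "X = word_class S' R' w"
      using \<open>X \<in> carrier ?P'\<close> by (auto simp: carrier_presented_group)
    have gens: "h (eval ?P ?c (g y)) = ?c' y" if "y \<in> S'" for y
      using that hw[of "g y"] fg[OF grp' c'] g by (simp add: eval_gen_class)
    have "h (k X) = eval ?P' (\<lambda>y. h (eval ?P ?c (g y))) w"
      using w kw hom_eval[OF grp grp' h ec w(1)] by simp
    also have "\<dots> = eval ?P' ?c' w"
      using w gens by (intro eval_cong) auto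
    finally show ?thesis using w by (simp add: eval_gen_class)
  qed
  ultimately have "bij_betw h (carrier ?P) (carrier ?P')"
    using h k by (intro bij_betw_byWitness[where f' = k]) (auto simp: hom_def Pi_iff)
  then show ?thesis
    using h by (auto simp: is_iso_def iso_def)
qed

section \<open>Conjugates, commuting and braiding in a group\<close>

context group
begin

definition conj :: "'a \<Rightarrow> 'a \<Rightarrow> 'a" (infixr "\<triangleright>" 75) where
  "g \<triangleright> x = g \<otimes> x \<otimes> inv g"

text \<open>The relation that a diagram imposes on two of its generators, with the truth value saying
  whether they are joined by an edge.\<close>

definition rel :: "bool \<Rightarrow> 'a \<Rightarrow> 'a \<Rightarrow> bool" where
  "rel b x y \<longleftrightarrow> (if b then x \<otimes> y \<otimes> x = y \<otimes> x \<otimes> y else x \<otimes> y = y \<otimes> x)"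

abbreviation "braids \<equiv> rel True"
abbreviation "commutes \<equiv> rel False"

lemma conj_closed [simp]: "g \<in> carrier G \<Longrightarrow> x \<in> carrier G \<Longrightarrow> g \<triangleright> x \<in> carrier G"
  by (simp add: conj_def)

lemma inv_cancel_left [simp]:
  assumes "x \<in> carrier G" "y \<in> carrier G"
  shows "inv x \<otimes> (x \<otimes> y) = y" "x \<otimes> (inv x \<otimes> y) = y"
  using assms by (simp_all add: m_assoc[symmetric])

lemma conj_conj:
  "g \<in> carrier G \<Longrightarrow> h \<in> carrier G \<Longrightarrow> x \<in> carrier G \<Longrightarrow> g \<triangleright> h \<triangleright> x = (g \<otimes> h) \<triangleright> x"
  by (simp add: conj_def inv_mult_group m_assoc)

lemma conj_inv_cancel [simp]:
  assumes "g \<in> carrier G" "x \<in> carrier G"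
  shows "inv g \<triangleright> g \<triangleright> x = x" "g \<triangleright> inv g \<triangleright> x = x"
  using assms by (simp_all add: conj_def m_assoc)

lemma conj_mult:
  "g \<in> carrier G \<Longrightarrow> x \<in> carrier G \<Longrightarrow> y \<in> carrier G \<Longrightarrow> g \<triangleright> (x \<otimes> y) = (g \<triangleright> x) \<otimes> (g \<triangleright> y)"
  by (simp add: conj_def m_assoc)

lemma conj_inv: "g \<in> carrier G \<Longrightarrow> x \<in> carrier G \<Longrightarrow> g \<triangleright> inv x = inv (g \<triangleright> x)"
  by (simp add: conj_def inv_mult_group m_assoc)

lemma conj_eq_iff [simp]:
  "g \<in> carrier G \<Longrightarrow> x \<in> carrier G \<Longrightarrow> y \<in> carrier G \<Longrightarrow> g \<triangleright> x = g \<triangleright> y \<longleftrightarrow> x = y"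
  by (metis conj_inv_cancel(1))

lemma rel_sym: "rel b x y \<longleftrightarrow> rel b y x"
  by (auto simp: rel_def)

lemma rel_refl [simp]: "rel b x x"
  by (simp add: rel_def)

lemma rel_conj [simp]:
  "g \<in> carrier G \<Longrightarrow> x \<in> carrier G \<Longrightarrow> y \<in> carrier G \<Longrightarrow> rel b (g \<triangleright> x) (g \<triangleright> y) \<longleftrightarrow> rel b x y"
  by (simp add: rel_def conj_mult[symmetric])

lemma conj_commutes: "commutes g x \<Longrightarrow> g \<in> carrier G \<Longrightarrow> x \<in> carrier G \<Longrightarrow> g \<triangleright> x = x"
  by (simp add: conj_def rel_def m_assoc)

lemma rel_inv [simp]:
  assumes "x \<in> carrier G" "y \<in> carrier G"
  shows "rel b (inv x) (inv y) \<longleftrightarrow> rel b x y"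
proof -
  have "inv x \<otimes> inv y \<otimes> inv x = inv (x \<otimes> y \<otimes> x)" "inv y \<otimes> inv x \<otimes> inv y = inv (y \<otimes> x \<otimes> y)"
    "inv x \<otimes> inv y = inv (y \<otimes> x)" "inv y \<otimes> inv x = inv (x \<otimes> y)"
    using assms by (simp_all add: inv_mult_group m_assoc)
  moreover have "inv a = inv c \<longleftrightarrow> a = c" if "a \<in> carrier G" "c \<in> carrier G" for a c
    using that by (metis inv_inv)
  ultimately show ?thesis
    using assms by (auto simp: rel_def simp del: inv_mult_group)
qed

lemma commutes_inv:
  assumes "commutes x y" "x \<in> carrier G" "y \<in> carrier G"
  shows "commutes (inv x) y"
proof -
  have "inv x \<triangleright> x \<triangleright> y = inv x \<triangleright> y"
    using conj_commutes[OF assms] by simp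
  then have "inv x \<otimes> y \<otimes> x = y"
    using assms by (simp add: conj_def m_assoc)
  then have "inv x \<otimes> y \<otimes> x \<otimes> inv x = y \<otimes> inv x" by simp
  then show ?thesis using assms by (simp add: rel_def m_assoc)
qed

lemma rel_conj_commutes:
  assumes "commutes x g" "x \<in> carrier G" "g \<in> carrier G" "y \<in> carrier G"
  shows "rel b x (g \<triangleright> y) \<longleftrightarrow> rel b x y"
  using assms rel_conj[of g x y b] conj_commutes[of g x] by (simp add: rel_sym)

lemma conj_swap:
  assumes "commutes g h" "g \<in> carrier G" "h \<in> carrier G" "x \<in> carrier G"
  shows "g \<triangleright> h \<triangleright> x = h \<triangleright> g \<triangleright> x"
  using assms by (simp add: conj_conj rel_def)

lemma conj_braids:
  assumes "braids g h" "g \<in> carrier G" "h \<in> carrier G"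
  shows "g \<triangleright> h \<triangleright> g = h"
proof -
  have "g \<triangleright> h \<triangleright> g = g \<otimes> h \<otimes> g \<otimes> inv h \<otimes> inv g"
    using assms by (simp add: conj_def m_assoc)
  also have "\<dots> = h \<otimes> g \<otimes> h \<otimes> inv h \<otimes> inv g"
    using assms(1) by (simp add: rel_def)
  also have "\<dots> = h" using assms by (simp add: m_assoc)
  finally show ?thesis .
qed

lemma conj_inv_braids:
  assumes "braids g h" "g \<in> carrier G" "h \<in> carrier G"
  shows "inv g \<triangleright> h = h \<triangleright> g"
  using conj_braids[OF assms] conj_inv_cancel(1)[of g "h \<triangleright> g"] assms by simp

text \<open>If g and h braid, then conjugation by gh takes g to h. This is the step that removes a
  letter g in front of h from a conjugate, and it carries most of the computations below.\<close>

lemma rel_conj_braids: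
  assumes "braids g h" "g \<in> carrier G" "h \<in> carrier G" "x \<in> carrier G"
  shows "rel b h (g \<triangleright> h \<triangleright> x) \<longleftrightarrow> rel b g x"
  using assms rel_conj[of g "h \<triangleright> g" "h \<triangleright> x" b] by (simp add: conj_braids)

text \<open>Because g and y braid, g \<triangleright> y is also the conjugate of g by y^-1, which
  commutes with h; so the claim is the braid relation of g and h conjugated by y^-1.\<close>

lemma braids_conj:
  assumes "commutes h y" "braids g y" "braids g h"
    and "g \<in> carrier G" "h \<in> carrier G" "y \<in> carrier G"
  shows "braids h (g \<triangleright> y)"
proof -
  have "g \<triangleright> y = inv y \<triangleright> g"
    using conj_inv_braids[of y g] assms by (simp add: rel_sym)
  moreover have "h = inv y \<triangleright> h"
    using assms conj_commutes[of "inv y" h] commutes_inv[of y h] by (simp add: rel_sym)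
  ultimately show ?thesis
    using assms rel_conj[of "inv y" h g True] by (metis inv_closed rel_sym)
qed

section \<open>Cycle commutators\<close>

definition cycle_commutes :: "'a \<Rightarrow> 'a \<Rightarrow> 'a \<Rightarrow> 'a \<Rightarrow> bool" where
  "cycle_commutes a b c d \<longleftrightarrow> commutes a (b \<triangleright> c \<triangleright> d)"

text \<open>Conjugating by b^-1 and using that b^-1 \<triangleright> a = a \<triangleright> b turns the
  statement about a into one about a \<triangleright> b; conjugating that by a^-1 leaves b on one
  side and moves a to the end of the cycle on the other. Commutation of the opposite vertices a
  and c lets a^-1 pass c.\<close>

lemma cycle_commutes_rotate:
  assumes "cycle_commutes a b c d" "braids a b" "braids d a" "commutes a c"
    and "a \<in> carrier G" "b \<in> carrier G" "c \<in> carrier G" "d \<in> carrier G"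
  shows "cycle_commutes b c d a"
proof -
  have "commutes (inv b \<triangleright> a) (c \<triangleright> d)"
    using assms rel_conj[of "inv b" a "b \<triangleright> c \<triangleright> d" False] by (simp add: cycle_commutes_def)
  then have "commutes (a \<triangleright> b) (c \<triangleright> d)"
    using assms conj_inv_braids[of b a] by (simp add: rel_sym)
  then have "commutes b (inv a \<triangleright> c \<triangleright> d)"
    using assms rel_conj[of "inv a" "a \<triangleright> b" "c \<triangleright> d" False] by simp
  also have "inv a \<triangleright> c \<triangleright> d = c \<triangleright> d \<triangleright> a"
    using assms conj_swap[of "inv a" c d] conj_inv_braids[of a d] commutes_inv[of a c]
    by (simp add: rel_sym)
  finally show ?thesis by (simp add: cycle_commutes_def)
qed

text \<open>The condition is symmetric under reading the cycle backwards with inverted elements: that a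
  commutes with b \<triangleright> c \<triangleright> d means that c^-1 \<triangleright> b^-1
  \<triangleright> a commutes with d.\<close>

lemma cycle_commutes_inv:
  assumes "cycle_commutes a b c d"
    and "a \<in> carrier G" "b \<in> carrier G" "c \<in> carrier G" "d \<in> carrier G"
  shows "cycle_commutes (inv d) (inv c) (inv b) (inv a)"
proof -
  have "commutes (inv c \<triangleright> inv b \<triangleright> a) d"
    using assms rel_conj[of "inv b" a "b \<triangleright> c \<triangleright> d" False]
      rel_conj[of "inv c" "inv b \<triangleright> a" "c \<triangleright> d" False] by (simp add: cycle_commutes_def)
  then show ?thesis
    using assms by (simp add: cycle_commutes_def conj_inv rel_sym)
qed

section \<open>Switching in a group\<close>

text \<open>The lemmas of this section compare the relations of v with those of the conjugate of v by
  qprq. The conjugation is undone by the inverses of p, q, r, which satisfy the same braid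
  relations; this is why it suffices to go from v to its conjugate.\<close>

definition switched :: "'a \<Rightarrow> 'a \<Rightarrow> 'a \<Rightarrow> 'a \<Rightarrow> 'a" where
  "switched p q r v = q \<triangleright> p \<triangleright> r \<triangleright> q \<triangleright> v"

lemma switched_closed [simp]:
  "p \<in> carrier G \<Longrightarrow> q \<in> carrier G \<Longrightarrow> r \<in> carrier G \<Longrightarrow> v \<in> carrier G \<Longrightarrow>
    switched p q r v \<in> carrier G"
  by (simp add: switched_def)

lemma switched_swap:
  assumes "commutes p r" "p \<in> carrier G" "q \<in> carrier G" "r \<in> carrier G" "v \<in> carrier G"
  shows "switched p q r v = switched r q p v"
  using assms conj_swap[of p r "q \<triangleright> v"] by (simp add: switched_def)

lemma commutes_switched_end:
  assumes "braids p q" "braids r q" "commutes p r" "commutes r v"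
    and "p \<in> carrier G" "q \<in> carrier G" "r \<in> carrier G" "v \<in> carrier G"
  shows "commutes p (switched p q r v)"
proof -
  have "commutes q (r \<triangleright> q \<triangleright> v)"
    using assms rel_conj_braids[of r q v False] by simp
  then show ?thesis
    using assms rel_conj_braids[of q p "r \<triangleright> q \<triangleright> v" False] by (simp add: switched_def rel_sym)
qed

lemma braids_switched_middle:
  assumes "braids p q" "braids r q" "braids q v" "commutes p r" "commutes p v" "commutes r v"
    and "p \<in> carrier G" "q \<in> carrier G" "r \<in> carrier G" "v \<in> carrier G"
  shows "braids q (switched p q r v)"
proof -
  have "commutes q (r \<triangleright> q \<triangleright> v)"
    using assms rel_conj_braids[of r q v False] by simp
  moreover have "braids p (r \<triangleright> q \<triangleright> v)"
    using assms rel_conj_commutes[of p r "q \<triangleright> v"] braids_conj[of p v q] by (simp add: rel_sym)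
  ultimately have "braids q (p \<triangleright> r \<triangleright> q \<triangleright> v)"
    using assms braids_conj[of q "r \<triangleright> q \<triangleright> v" p] by (simp add: rel_sym)
  then show ?thesis
    using assms rel_conj_commutes[of q q "p \<triangleright> r \<triangleright> q \<triangleright> v" True] by (simp add: switched_def)
qed

lemma rel_switched_far:
  assumes "commutes x p" "commutes x q" "commutes x r"
    and "x \<in> carrier G" "p \<in> carrier G" "q \<in> carrier G" "r \<in> carrier G" "v \<in> carrier G"
  shows "rel b x (switched p q r v) \<longleftrightarrow> rel b x v"
  using assms by (simp add: switched_def rel_conj_commutes)

text \<open>For a neighbour x of p the letters q and r can be dropped. What remains for commuting is the
  cycle commutator of x, p, q, v.\<close>

lemma rel_switched_end_neighbour:
  assumes "commutes x q" "commutes x r" "commutes p r"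
    and "x \<in> carrier G" "p \<in> carrier G" "q \<in> carrier G" "r \<in> carrier G" "v \<in> carrier G"
  shows "rel b x (switched p q r v) \<longleftrightarrow> rel b x (p \<triangleright> q \<triangleright> v)"
  using assms conj_swap[of p r "q \<triangleright> v"] by (simp add: switched_def rel_conj_commutes)

lemma braids_switched:
  assumes "commutes x q" "commutes x r" "commutes p r" "braids x p" "commutes p v" "braids q v"
    "braids p q" "commutes x v"
    and "x \<in> carrier G" "p \<in> carrier G" "q \<in> carrier G" "r \<in> carrier G" "v \<in> carrier G"
  shows "braids x (switched p q r v)"
proof -
  have "braids p (q \<triangleright> v)"
    using assms braids_conj[of p v q] by (simp add: rel_sym)
  moreover have "commutes x (q \<triangleright> v)"
    using assms by (simp add: rel_conj_commutes)
  ultimately have "braids x (p \<triangleright> q \<triangleright> v)"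
    using assms braids_conj[of x "q \<triangleright> v" p] by (simp add: rel_sym)
  then show ?thesis using assms by (simp add: rel_switched_end_neighbour)
qed

text \<open>Removing qp from the switched element leaves r \<triangleright> q \<triangleright> v, with
  which x commutes because it commutes with each of the three letters.\<close>

lemma cycle_commutes_switched:
  assumes "commutes x q" "commutes x r" "commutes p r" "braids p q" "commutes x v"
    and "x \<in> carrier G" "p \<in> carrier G" "q \<in> carrier G" "r \<in> carrier G" "v \<in> carrier G"
  shows "cycle_commutes (switched p q r v) q p x"
proof -
  have "commutes (r \<triangleright> q \<triangleright> v) x"
    using assms rel_conj_commutes[of x r "q \<triangleright> v" False] rel_conj_commutes[of x q v False]
    by (simp add: rel_sym)
  then show ?thesis
    using assms rel_conj[of q "p \<triangleright> r \<triangleright> q \<triangleright> v" "p \<triangleright> x" False] 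
    by (simp add: cycle_commutes_def switched_def)
qed

end

section \<open>Realizations of diagrams with distinguished squares\<close>

text \<open>All presentations in the proof are of this form. The squares are recorded separately from
  the diagram because they carry a direction, and Q need not be closed under rotation.\<close>

definition square_group :: "'v diagram \<Rightarrow> 'v quad set \<Rightarrow> 'v word set monoid" where
  "square_group D Q = presented_group (verts D) (braid_relations D \<union> cc_relations Q)"

lemma artin_group_eq_square_group: "artin_group D = square_group D {}"
  by (simp add: artin_group_def square_group_def cc_relations_def)

text \<open>What an assignment has to satisfy to define a homomorphism from the square group, expressed
  in the group rather than with words.\<close>

definition realizes :: "('g, 'm) monoid_scheme \<Rightarrow> ('v \<Rightarrow> 'g) \<Rightarrow> 'v diagram \<Rightarrow> 'v quad set \<Rightarrow> bool" where
  "realizes G \<phi> D Q \<longleftrightarrow> \<phi> \<in> verts D \<rightarrow> carrier G \<and>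
     (\<forall>x\<in>verts D. \<forall>y\<in>verts D. x \<noteq> y \<longrightarrow> group.rel G ({x, y} \<in> edges D) (\<phi> x) (\<phi> y)) \<and>
     (\<forall>(a, b, c, d)\<in>Q. group.cycle_commutes G (\<phi> a) (\<phi> b) (\<phi> c) (\<phi> d))"

abbreviation quads :: "'v diagram \<Rightarrow> 'v quad set" where
  "quads D \<equiv> verts D \<times> verts D \<times> verts D \<times> verts D"

context group
begin

lemma eval_cc:
  assumes "\<phi> \<in> S \<rightarrow> carrier G" "a \<in> S" "b \<in> S" "c \<in> S" "d \<in> S"
  shows "eval G \<phi> (cc (a, b, c, d)) = \<one> \<longleftrightarrow> cycle_commutes (\<phi> a) (\<phi> b) (\<phi> c) (\<phi> d)"
proof -
  have car: "\<phi> a \<in> carrier G" "\<phi> b \<in> carrier G" "\<phi> c \<in> carrier G" "\<phi> d \<in> carrier G"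
    using assms by auto
  define y where "y = \<phi> b \<triangleright> \<phi> c \<triangleright> \<phi> d"
  have y: "y \<in> carrier G" using car by (simp add: y_def)
  have "eval G \<phi> (cc (a, b, c, d)) = \<phi> a \<otimes> y \<otimes> inv \<phi> a \<otimes> inv y"
    using car unfolding cc_def commutator_def gen_def
    by (simp add: y_def conj_def inv_mult_group m_assoc)
  also have "\<dots> = (\<phi> a \<otimes> y) \<otimes> inv (y \<otimes> \<phi> a)"
    using car y by (simp add: inv_mult_group m_assoc)
  finally have "eval G \<phi> (cc (a, b, c, d)) = \<one> \<longleftrightarrow> \<phi> a \<otimes> y = y \<otimes> \<phi> a"
    using car y by (metis inv_closed inv_equality inv_inv m_closed r_inv)
  then show ?thesis by (simp add: cycle_commutes_def rel_def y_def)
qed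

lemma satisfies_iff_realizes:
  assumes "Q \<subseteq> quads D"
  shows "satisfies G \<phi> (verts D) (braid_relations D \<union> cc_relations Q) \<longleftrightarrow> realizes G \<phi> D Q"
proof (cases "\<phi> \<in> verts D \<rightarrow> carrier G")
  case True
  then have car: "\<And>x. x \<in> verts D \<Longrightarrow> \<phi> x \<in> carrier G" by auto
  have braid: "(\<forall>(l, r)\<in>braid_relations D. l \<in> words (verts D) \<longrightarrow> r \<in> words (verts D) \<longrightarrow>
        eval G \<phi> l = eval G \<phi> r)
      \<longleftrightarrow> (\<forall>x\<in>verts D. \<forall>y\<in>verts D. x \<noteq> y \<longrightarrow> rel ({x, y} \<in> edges D) (\<phi> x) (\<phi> y))"
    (is "?L = ?R")
  proof
    assume L: ?L
    show ?R
    proof (intro ballI impI)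
      fix x y assume xy: "x \<in> verts D" "y \<in> verts D" "x \<noteq> y"
      show "rel ({x, y} \<in> edges D) (\<phi> x) (\<phi> y)"
      proof (cases "{x, y} \<in> edges D")
        case True
        then have "(gen x @ gen y @ gen x, gen y @ gen x @ gen y) \<in> braid_relations D"
          using xy by (auto simp: braid_relations_def)
        then show ?thesis
          using L xy car True by (fastforce simp: rel_def gen_def m_assoc)
      next
        case False
        then have "(gen x @ gen y, gen y @ gen x) \<in> braid_relations D"
          using xy by (auto simp: braid_relations_def)
        then show ?thesis
          using L xy car False by (fastforce simp: rel_def gen_def)
      qed
    qed
  next
    assume R: ?R
    have "eval G \<phi> l = eval G \<phi> r" if "(l, r) \<in> braid_relations D" for l r
      using that unfolding braid_relations_def
    proof
      assume "(l, r) \<in> {(gen s @ gen t @ gen s, gen t @ gen s @ gen t) |s t.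
        s \<in> verts D \<and> t \<in> verts D \<and> {s, t} \<in> edges D}"
      then obtain s t where st: "s \<in> verts D" "t \<in> verts D" "{s, t} \<in> edges D"
        "l = gen s @ gen t @ gen s" "r = gen t @ gen s @ gen t" by blast
      then show ?thesis
        using R[rule_format, of s t] car by (cases "s = t") (auto simp: rel_def gen_def m_assoc)
    next
      assume "(l, r) \<in> {(gen s @ gen t, gen t @ gen s) |s t.
        s \<in> verts D \<and> t \<in> verts D \<and> s \<noteq> t \<and> {s, t} \<notin> edges D}"
      then obtain s t where st: "s \<in> verts D" "t \<in> verts D" "s \<noteq> t" "{s, t} \<notin> edges D"
        "l = gen s @ gen t" "r = gen t @ gen s" by blast
      then show ?thesis
        using R[rule_format, of s t] car by (auto simp: rel_def gen_def)
    qed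
    then show ?L by blast
  qed
  have "(\<forall>(l, r)\<in>cc_relations Q. l \<in> words (verts D) \<longrightarrow> r \<in> words (verts D) \<longrightarrow>
        eval G \<phi> l = eval G \<phi> r)
      \<longleftrightarrow> (\<forall>q\<in>Q. eval G \<phi> (cc q) = \<one>)" (is "?L = ?R")
  proof -
    have "cc q \<in> words (verts D)" if "q \<in> Q" for q
      using that assms by (auto simp: cc_def commutator_def)
    moreover have "cc_relations Q = (\<lambda>q. (cc q, [])) ` Q"
      by (auto simp: cc_relations_def)
    ultimately show ?thesis by simp
  qed
  also have "\<dots> \<longleftrightarrow> (\<forall>(a, b, c, d)\<in>Q. cycle_commutes (\<phi> a) (\<phi> b) (\<phi> c) (\<phi> d))"
  proof (rule ball_cong[OF HOL.refl])
    fix z assume "z \<in> Q"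
    moreover obtain a b c d where z: "z = (a, b, c, d)" by (cases z)
    ultimately have "a \<in> verts D" "b \<in> verts D" "c \<in> verts D" "d \<in> verts D"
      using assms by auto
    then show "(eval G \<phi> (cc z) = \<one>) = (case z of (a, b, c, d) \<Rightarrow>
        cycle_commutes (\<phi> a) (\<phi> b) (\<phi> c) (\<phi> d))"
      using eval_cc[OF True] by (simp add: z)
  qed
  finally show ?thesis
    using True braid by (simp add: satisfies_def realizes_def ball_Un)
qed (simp add: satisfies_def realizes_def)

lemma realizesD:
  assumes "realizes G \<phi> D Q"
  shows "x \<in> verts D \<Longrightarrow> \<phi> x \<in> carrier G"
    and "x \<in> verts D \<Longrightarrow> y \<in> verts D \<Longrightarrow> x \<noteq> y \<Longrightarrow> rel ({x, y} \<in> edges D) (\<phi> x) (\<phi> y)"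
    and "(a, b, c, d) \<in> Q \<Longrightarrow> cycle_commutes (\<phi> a) (\<phi> b) (\<phi> c) (\<phi> d)"
  using assms unfolding realizes_def by auto

end

lemma realizes_cong:
  assumes "\<And>x. x \<in> verts D \<Longrightarrow> \<phi> x = \<psi> x" "Q \<subseteq> quads D"
  shows "realizes G \<phi> D Q \<longleftrightarrow> realizes G \<psi> D Q"
proof -
  have "(\<forall>(a, b, c, d)\<in>Q. group.cycle_commutes G (\<phi> a) (\<phi> b) (\<phi> c) (\<phi> d)) \<longleftrightarrow>
    (\<forall>(a, b, c, d)\<in>Q. group.cycle_commutes G (\<psi> a) (\<psi> b) (\<psi> c) (\<psi> d))"
    using assms by (intro ball_cong) auto
  moreover have "\<phi> \<in> verts D \<rightarrow> carrier G \<longleftrightarrow> \<psi> \<in> verts D \<rightarrow> carrier G"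
    using assms(1) by (auto simp: Pi_iff)
  ultimately show ?thesis
    using assms(1) by (simp add: realizes_def)
qed

lemma square_group_iso:
  fixes D :: "'v diagram" and D' :: "'w diagram"
  assumes quads: "Q \<subseteq> quads D" "Q' \<subseteq> quads D'"
    and f: "\<And>x. x \<in> verts D \<Longrightarrow> f x \<in> words (verts D')"
    and g: "\<And>y. y \<in> verts D' \<Longrightarrow> g y \<in> words (verts D)"
    and fwd: "\<And>(G :: 'w word set monoid) \<phi>. group G \<Longrightarrow> realizes G \<phi> D' Q' \<Longrightarrow>
      realizes G (\<lambda>x. eval G \<phi> (f x)) D Q"
    and bwd: "\<And>(G :: 'v word set monoid) \<phi>. group G \<Longrightarrow> realizes G \<phi> D Q \<Longrightarrow>
      realizes G (\<lambda>y. eval G \<phi> (g y)) D' Q'"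
    and gf: "\<And>(G :: 'v word set monoid) \<phi> x. group G \<Longrightarrow> \<phi> \<in> verts D \<rightarrow> carrier G \<Longrightarrow> x \<in> verts D \<Longrightarrow>
      eval G (\<lambda>y. eval G \<phi> (g y)) (f x) = \<phi> x"
    and fg: "\<And>(G :: 'w word set monoid) \<phi> y. group G \<Longrightarrow> \<phi> \<in> verts D' \<rightarrow> carrier G \<Longrightarrow> y \<in> verts D' \<Longrightarrow>
      eval G (\<lambda>x. eval G \<phi> (f x)) (g y) = \<phi> y"
  shows "square_group D Q \<cong> square_group D' Q'"
  unfolding square_group_def
  by (rule presented_group_iso[where f = f and g = g])
     (use assms in \<open>simp_all add: group.satisfies_iff_realizes\<close>)

section \<open>Relabelling, rotation and reversal\<close>

text \<open>The diagonals must not be edges: rotating a cycle commutator uses that opposite vertices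
  commute.\<close>

definition induced_squares :: "'v diagram \<Rightarrow> 'v quad set" where
  "induced_squares D = {(a, b, c, d). a \<in> verts D \<and> b \<in> verts D \<and> c \<in> verts D \<and> d \<in> verts D \<and>
     distinct [a, b, c, d] \<and> {a, b} \<in> edges D \<and> {b, c} \<in> edges D \<and> {c, d} \<in> edges D \<and>
     {d, a} \<in> edges D \<and> {a, c} \<notin> edges D \<and> {b, d} \<notin> edges D}"

lemma induced_squares_quads: "induced_squares D \<subseteq> quads D"
  by (auto simp: induced_squares_def)

lemma rotations_induced: "q' \<in> rotations q \<Longrightarrow> q \<in> induced_squares D \<Longrightarrow> q' \<in> induced_squares D"
  by (auto simp: rotations_def induced_squares_def insert_commute)

definition reverse_quad :: "'v quad \<Rightarrow> 'v quad" where
  "reverse_quad = (\<lambda>(a, b, c, d). (d, c, b, a))"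

definition map_quad :: "('v \<Rightarrow> 'w) \<Rightarrow> 'v quad \<Rightarrow> 'w quad" where
  "map_quad \<sigma> = (\<lambda>(a, b, c, d). (\<sigma> a, \<sigma> b, \<sigma> c, \<sigma> d))"

lemma (in group) cycle_commutes_rotations:
  assumes "realizes G \<phi> D Q" "q \<in> Q" "q \<in> induced_squares D" "(a, b, c, d) \<in> rotations q"
  shows "cycle_commutes (\<phi> a) (\<phi> b) (\<phi> c) (\<phi> d)"
proof -
  obtain s t u w where q: "q = (s, t, u, w)" by (cases q)
  note r = realizesD[OF assms(1)]
  have v: "s \<in> verts D" "t \<in> verts D" "u \<in> verts D" "w \<in> verts D"
    using assms(3) by (auto simp: q induced_squares_def)
  have e: "braids (\<phi> s) (\<phi> t)" "braids (\<phi> t) (\<phi> u)" "braids (\<phi> u) (\<phi> w)" "braids (\<phi> w) (\<phi> s)"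
    "commutes (\<phi> s) (\<phi> u)" "commutes (\<phi> t) (\<phi> w)" "commutes (\<phi> u) (\<phi> s)"
    using assms(3) r(2)[of s t] r(2)[of t u] r(2)[of u w] r(2)[of w s] r(2)[of s u] r(2)[of t w]
    by (auto simp: q induced_squares_def rel_sym)
  have 1: "cycle_commutes (\<phi> s) (\<phi> t) (\<phi> u) (\<phi> w)"
    using r(3) assms(2) by (simp add: q)
  have 2: "cycle_commutes (\<phi> t) (\<phi> u) (\<phi> w) (\<phi> s)"
    using cycle_commutes_rotate[OF 1] e v r(1) by simp
  have 3: "cycle_commutes (\<phi> u) (\<phi> w) (\<phi> s) (\<phi> t)"
    using cycle_commutes_rotate[OF 2] e v r(1) by simp
  have 4: "cycle_commutes (\<phi> w) (\<phi> s) (\<phi> t) (\<phi> u)"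
    using cycle_commutes_rotate[OF 3] e v r(1) by simp
  show ?thesis
    using assms(4) 1 2 3 4 by (auto simp: q rotations_def)
qed

lemma (in group) realizes_relabel:
  assumes "realizes G \<phi> D' Q'" "Q' \<subseteq> induced_squares D'"
    and "\<sigma> ` verts D \<subseteq> verts D'" "inj_on \<sigma> (verts D)"
    and "\<And>x y. x \<in> verts D \<Longrightarrow> y \<in> verts D \<Longrightarrow> x \<noteq> y \<Longrightarrow>
      {\<sigma> x, \<sigma> y} \<in> edges D' \<longleftrightarrow> {x, y} \<in> edges D"
    and "map_quad \<sigma> ` Q \<subseteq> (\<Union>q\<in>Q'. rotations q)"
  shows "realizes G (\<lambda>x. \<phi> (\<sigma> x)) D Q"
proof -
  note r = realizesD[OF assms(1)]
  have "cycle_commutes (\<phi> (\<sigma> a)) (\<phi> (\<sigma> b)) (\<phi> (\<sigma> c)) (\<phi> (\<sigma> d))" if "(a, b, c, d) \<in> Q" for a b c d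
  proof -
    have "map_quad \<sigma> (a, b, c, d) \<in> (\<Union>q\<in>Q'. rotations q)"
      using assms(6) that by blast
    then obtain q where "q \<in> Q'" "(\<sigma> a, \<sigma> b, \<sigma> c, \<sigma> d) \<in> rotations q"
      by (auto simp: map_quad_def)
    then show ?thesis
      using cycle_commutes_rotations[OF assms(1)] assms(2) by blast
  qed
  moreover have "rel ({x, y} \<in> edges D) (\<phi> (\<sigma> x)) (\<phi> (\<sigma> y))"
    if "x \<in> verts D" "y \<in> verts D" "x \<noteq> y" for x y
  proof -
    have "\<sigma> x \<in> verts D'" "\<sigma> y \<in> verts D'" "\<sigma> x \<noteq> \<sigma> y"
      using that assms(3,4) by (auto simp: inj_on_def)
    then show ?thesis
      using r(2)[of "\<sigma> x" "\<sigma> y"] assms(5)[OF that] by simp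
  qed
  ultimately show ?thesis
    using r(1) assms(3) unfolding realizes_def by auto
qed

text \<open>An isomorphism of diagrams induces one of the groups. The squares only have to correspond up
  to rotation.\<close>

lemma square_group_relabel:
  assumes bij: "bij_betw \<sigma> (verts D) (verts D')"
    and edges: "\<And>x y. x \<in> verts D \<Longrightarrow> y \<in> verts D \<Longrightarrow> x \<noteq> y \<Longrightarrow>
      {\<sigma> x, \<sigma> y} \<in> edges D' \<longleftrightarrow> {x, y} \<in> edges D"
    and Q: "Q \<subseteq> quads D" and Q': "Q' \<subseteq> induced_squares D'"
    and 1: "map_quad \<sigma> ` Q \<subseteq> (\<Union>q\<in>Q'. rotations q)"
    and 2: "Q' \<subseteq> (\<Union>q\<in>Q. rotations (map_quad \<sigma> q))"
  shows "square_group D Q \<cong> square_group D' Q'"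
proof -
  define \<tau> where "\<tau> = inv_into (verts D) \<sigma>"
  have \<sigma>: "\<sigma> x \<in> verts D'" "\<tau> (\<sigma> x) = x" if "x \<in> verts D" for x
    using that bij by (auto simp: \<tau>_def bij_betw_def)
  have \<tau>: "\<tau> y \<in> verts D" "\<sigma> (\<tau> y) = y" if "y \<in> verts D'" for y
    using that bij by (auto simp: \<tau>_def bij_betw_def inv_into_into f_inv_into_f)
  have quads: "Q \<subseteq> quads D" "Q' \<subseteq> quads D'"
    using Q Q' induced_squares_quads by blast+
  have induced: "Q \<subseteq> induced_squares D"
  proof
    fix q assume "q \<in> Q"
    obtain a b c d where q: "q = (a, b, c, d)" by (cases q)
    have v: "a \<in> verts D" "b \<in> verts D" "c \<in> verts D" "d \<in> verts D"
      using \<open>q \<in> Q\<close> Q by (auto simp: q)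
    obtain q' where "q' \<in> Q'" "map_quad \<sigma> q \<in> rotations q'"
      using 1 \<open>q \<in> Q\<close> by blast
    then have "map_quad \<sigma> q \<in> induced_squares D'"
      using Q' rotations_induced by blast
    then show "q \<in> induced_squares D"
      using v edges[of a b] edges[of b c] edges[of c d] edges[of d a] edges[of a c] edges[of b d]
      by (auto simp: q map_quad_def induced_squares_def)
  qed
  have edges': "{\<tau> x, \<tau> y} \<in> edges D \<longleftrightarrow> {x, y} \<in> edges D'"
    if "x \<in> verts D'" "y \<in> verts D'" "x \<noteq> y" for x y
  proof -
    have "\<tau> x \<noteq> \<tau> y" using \<tau>(2) that by metis
    then show ?thesis
      using edges[of "\<tau> x" "\<tau> y"] \<tau> that by simp
  qed
  have backward: "map_quad \<tau> ` Q' \<subseteq> (\<Union>q\<in>Q. rotations q)"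
  proof
    fix z assume "z \<in> map_quad \<tau> ` Q'"
    then obtain q q' where q: "q \<in> Q" "q' \<in> rotations (map_quad \<sigma> q)" "z = map_quad \<tau> q'"
      using 2 by blast
    obtain a b c d where abcd: "q = (a, b, c, d)" by (cases q)
    have "\<tau> (\<sigma> a) = a" "\<tau> (\<sigma> b) = b" "\<tau> (\<sigma> c) = c" "\<tau> (\<sigma> d) = d"
      using quads(1) q(1) \<sigma>(2) by (auto simp: abcd)
    then have "z \<in> rotations q"
      using q(2,3) by (auto simp: abcd map_quad_def rotations_def)
    with q show "z \<in> (\<Union>q\<in>Q. rotations q)" by blast
  qed
  show ?thesis
  proof (rule square_group_iso[where f = "\<lambda>x. gen (\<sigma> x)" and g = "\<lambda>y. gen (\<tau> y)"])
    fix G :: "'b word set monoid" and \<phi>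
    assume "group G" and r: "realizes G \<phi> D' Q'"
    then interpret group G by simp
    have "realizes G (\<lambda>x. \<phi> (\<sigma> x)) D Q"
      using realizes_relabel[OF r Q' _ _ edges 1] bij by (auto simp: bij_betw_def)
    then show "realizes G (\<lambda>x. eval G \<phi> (gen (\<sigma> x))) D Q"
      using realizesD(1)[OF r] \<sigma> quads
      by (subst realizes_cong[where \<psi> = "\<lambda>x. \<phi> (\<sigma> x)"]) (auto simp: eval_gen)
  next
    fix G :: "'a word set monoid" and \<phi>
    assume "group G" and r: "realizes G \<phi> D Q"
    then interpret group G by simp
    have "\<tau> ` verts D' \<subseteq> verts D" "inj_on \<tau> (verts D')"
      using \<tau> by (auto intro: inj_on_inverseI[where g = \<sigma>])
    then have "realizes G (\<lambda>y. \<phi> (\<tau> y)) D' Q'"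
      using realizes_relabel[OF r induced _ _ edges' backward] by simp
    then show "realizes G (\<lambda>y. eval G \<phi> (gen (\<tau> y))) D' Q'"
      using realizesD(1)[OF r] \<tau> quads
      by (subst realizes_cong[where \<psi> = "\<lambda>y. \<phi> (\<tau> y)"]) (auto simp: eval_gen)
  next
    fix G :: "'a word set monoid" and \<phi> x
    assume "group G" "\<phi> \<in> verts D \<rightarrow> carrier G" "x \<in> verts D"
    then show "eval G (\<lambda>y. eval G \<phi> (gen (\<tau> y))) (gen (\<sigma> x)) = \<phi> x"
      by (simp add: group.eval_gen \<sigma> Pi_iff)
  next
    fix G :: "'b word set monoid" and \<phi> y
    assume "group G" "\<phi> \<in> verts D' \<rightarrow> carrier G" "y \<in> verts D'"
    then show "eval G (\<lambda>x. eval G \<phi> (gen (\<sigma> x))) (gen (\<tau> y)) = \<phi> y"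
      by (simp add: group.eval_gen \<tau> Pi_iff)
  qed (use quads \<sigma> \<tau> in auto)
qed

lemma (in group) realizes_inv:
  assumes "realizes G \<phi> D Q" "Q \<subseteq> quads D"
  shows "realizes G (\<lambda>x. inv (\<phi> x)) D (reverse_quad ` Q)"
proof -
  note r = realizesD[OF assms(1)]
  have "cycle_commutes (inv (\<phi> d)) (inv (\<phi> c)) (inv (\<phi> b)) (inv (\<phi> a))"
    if "(a, b, c, d) \<in> Q" for a b c d
    using r that assms(2) by (intro cycle_commutes_inv) auto
  then show ?thesis
    using r unfolding realizes_def reverse_quad_def by auto
qed

lemma reverse_quad_reverse_quad [simp]: "reverse_quad (reverse_quad q) = q"
  by (cases q) (simp add: reverse_quad_def)

lemma reverse_quad_image_image [simp]: "reverse_quad ` reverse_quad ` Q = Q"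
  by (simp add: image_image)

lemma reverse_quad_quads: "Q \<subseteq> quads D \<Longrightarrow> reverse_quad ` Q \<subseteq> quads D"
  by (auto simp: reverse_quad_def)

text \<open>Inverting every generator is an isomorphism between the presentations for the two directions
  of the squares.\<close>

lemma square_group_reverse:
  assumes "Q \<subseteq> quads D"
  shows "square_group D Q \<cong> square_group D (reverse_quad ` Q)"
proof -
  have inv_inv: "eval G (\<lambda>y. eval G \<phi> (winv (gen y))) (winv (gen x)) = \<phi> x"
    if "group G" "\<phi> \<in> verts D \<rightarrow> carrier G" "x \<in> verts D" for G :: "'a word set monoid" and \<phi> x
  proof -
    interpret group G by fact
    show ?thesis using that by (auto simp: gen_def Pi_iff)
  qed
  have realizes: "realizes G (\<lambda>x. eval G \<phi> (winv (gen x))) D (reverse_quad ` Q)"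
    if "group G" "realizes G \<phi> D Q" "Q \<subseteq> quads D" for G :: "'a word set monoid" and \<phi> Q
  proof -
    interpret group G by fact
    show ?thesis
      using realizes_inv[OF that(2,3)] realizesD(1)[OF that(2)] that(3)
      by (subst realizes_cong[where \<psi> = "\<lambda>x. inv\<^bsub>G\<^esub> (\<phi> x)"])
         (auto simp: gen_def reverse_quad_quads)
  qed
  show ?thesis
  proof (rule square_group_iso[where f = "\<lambda>x. winv (gen x)" and g = "\<lambda>x. winv (gen x)"])
    fix G :: "'a word set monoid" and \<phi>
    assume "group G" "realizes G \<phi> D (reverse_quad ` Q)"
    then show "realizes G (\<lambda>x. eval G \<phi> (winv (gen x))) D Q"
      using realizes[of G \<phi> "reverse_quad ` Q"] assms by (simp add: reverse_quad_quads)
    next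
    fix G :: "'a word set monoid" and \<phi>
    assume "group G" "realizes G \<phi> D Q"
    then show "realizes G (\<lambda>x. eval G \<phi> (winv (gen x))) D (reverse_quad ` Q)"
      using realizes[of G \<phi> Q] assms by simp
  next
    show "reverse_quad ` Q \<subseteq> quads D" by (rule reverse_quad_quads[OF assms])
  qed (use assms inv_inv in \<open>simp_all only: winv_in_words words_simps\<close>)
qed

lemma square_group_rotations:
  assumes "Q \<subseteq> induced_squares D" "Q' \<subseteq> induced_squares D"
    and "Q \<subseteq> (\<Union>q\<in>Q'. rotations q)" "Q' \<subseteq> (\<Union>q\<in>Q. rotations q)"
  shows "square_group D Q \<cong> square_group D Q'"
proof -
  have id: "map_quad (\<lambda>x. x) q = q" for q :: "'a quad"
    by (cases q) (simp add: map_quad_def)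
  have "Q \<subseteq> quads D" using assms(1) induced_squares_quads by blast
  then show ?thesis
    using assms by (intro square_group_relabel[where \<sigma> = "\<lambda>x. x"]) (auto simp: bij_betw_def id)
qed

lemma square_group_unreverse:
  assumes "square_group D Q \<cong> H" "Q \<subseteq> induced_squares D"
  shows "square_group D (reverse_quad ` Q) \<cong> H"
proof -
  have "Q \<subseteq> quads D" using assms(2) induced_squares_quads by blast
  then have "square_group D (reverse_quad ` Q) \<cong> square_group D Q"
    using square_group_reverse[OF reverse_quad_quads, of Q D] by simp
  then show ?thesis using assms(1) by (rule iso_trans)
qed

section \<open>Switching a diagram\<close>

text \<open>The configuration in which v may be switched along the path p - q - r: a further vertex is
  joined to at most one vertex of the path, and not to the middle one.\<close>

definition switchable :: "'v diagram \<Rightarrow> 'v \<Rightarrow> 'v \<Rightarrow> 'v \<Rightarrow> 'v \<Rightarrow> bool" where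
  "switchable D p q r v \<longleftrightarrow> {p, q, r, v} \<subseteq> verts D \<and> distinct [p, q, r, v] \<and>
     {p, q} \<in> edges D \<and> {r, q} \<in> edges D \<and> {q, v} \<in> edges D \<and>
     {p, r} \<notin> edges D \<and> {p, v} \<notin> edges D \<and> {r, v} \<notin> edges D \<and>
     (\<forall>x \<in> verts D. x \<notin> {p, q, r, v} \<longrightarrow>
        {x, q} \<notin> edges D \<and> \<not> ({x, p} \<in> edges D \<and> {x, r} \<in> edges D))"

text \<open>The vertices whose edge to v changes. The middle q is adjacent to both ends and has to be
  excluded explicitly.\<close>

definition toggled :: "'v diagram \<Rightarrow> 'v \<Rightarrow> 'v \<Rightarrow> 'v \<Rightarrow> 'v \<Rightarrow> bool" where
  "toggled D p q r x \<longleftrightarrow> x \<notin> {p, q, r} \<and> ({x, p} \<in> edges D \<or> {x, r} \<in> edges D)"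

definition switched_edge :: "'v diagram \<Rightarrow> 'v \<Rightarrow> 'v \<Rightarrow> 'v \<Rightarrow> 'v \<Rightarrow> 'v \<Rightarrow> 'v \<Rightarrow> bool" where
  "switched_edge D p q r v x y \<longleftrightarrow>
     ({x, y} \<in> edges D) \<noteq> (x = v \<and> toggled D p q r y \<or> y = v \<and> toggled D p q r x)"

definition switch :: "'v diagram \<Rightarrow> 'v \<Rightarrow> 'v \<Rightarrow> 'v \<Rightarrow> 'v \<Rightarrow> 'v diagram" where
  "switch D p q r v =
     \<lparr> verts = verts D,
       edges = {{x, y} | x y. x \<in> verts D \<and> y \<in> verts D \<and> x \<noteq> y \<and> switched_edge D p q r v x y} \<rparr>"

text \<open>The squares through v, q and an end of the path, each with the direction and starting vertex
  for which the cycle commutator says that its vertex x commutes with the switched generator.\<close>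

definition switch_squares :: "'v diagram \<Rightarrow> 'v \<Rightarrow> 'v \<Rightarrow> 'v \<Rightarrow> 'v \<Rightarrow> 'v quad set" where
  "switch_squares D p q r v = {(x, s, q, v) | x s. s \<in> {p, r} \<and> x \<in> verts D - {p, q, r, v} \<and>
     {x, s} \<in> edges D \<and> {x, v} \<in> edges D}"

text \<open>Being a switch of one another is a symmetric relation between diagrams. This is what makes
  the backward translation another instance of the forward one.\<close>

definition switch_related :: "'v diagram \<Rightarrow> 'v diagram \<Rightarrow> 'v \<Rightarrow> 'v \<Rightarrow> 'v \<Rightarrow> 'v \<Rightarrow> bool" where
  "switch_related D D' p q r v \<longleftrightarrow> switchable D p q r v \<and> verts D' = verts D \<and>
     (\<forall>x \<in> verts D. \<forall>y \<in> verts D. x \<noteq> y \<longrightarrow> ({x, y} \<in> edges D' \<longleftrightarrow> switched_edge D p q r v x y))"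

lemma verts_switch [simp]: "verts (switch D p q r v) = verts D"
  by (simp add: switch_def)

lemma switch_edges_iff:
  assumes "x \<in> verts D" "y \<in> verts D" "x \<noteq> y"
  shows "{x, y} \<in> edges (switch D p q r v) \<longleftrightarrow> switched_edge D p q r v x y"
  using assms by (auto simp: switch_def switched_edge_def doubleton_eq_iff insert_commute)

lemma switch_related_switch: "switchable D p q r v \<Longrightarrow> switch_related D (switch D p q r v) p q r v"
  by (simp add: switch_related_def switch_edges_iff)

lemma switch_related_sym:
  assumes "switch_related D D' p q r v"
  shows "switch_related D' D p q r v"
proof -
  have s: "switchable D p q r v" and V: "verts D' = verts D"
    and E: "\<And>x y. x \<in> verts D \<Longrightarrow> y \<in> verts D \<Longrightarrow> x \<noteq> y \<Longrightarrow>
      {x, y} \<in> edges D' \<longleftrightarrow> switched_edge D p q r v x y"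
    using assms by (auto simp: switch_related_def)
  have pqrv: "p \<in> verts D" "q \<in> verts D" "r \<in> verts D" "v \<in> verts D" "distinct [p, q, r, v]"
    using s by (auto simp: switchable_def)
  have off: "{x, y} \<in> edges D' \<longleftrightarrow> {x, y} \<in> edges D"
    if "x \<in> verts D" "y \<in> verts D" "x \<noteq> y" "x \<noteq> v" "y \<noteq> v" for x y
    using E that by (simp add: switched_edge_def)
  have at: "{x, v} \<in> edges D' \<longleftrightarrow> ({x, v} \<in> edges D) \<noteq> toggled D p q r x"
    if "x \<in> verts D" "x \<noteq> v" for x
    using E[of x v] that pqrv by (simp add: switched_edge_def)
  have tog: "toggled D' p q r x \<longleftrightarrow> toggled D p q r x" if "x \<in> verts D" "x \<noteq> v" for x
    using that pqrv off[of x p] off[of x r] by (auto simp: toggled_def)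
  have "switchable D' p q r v"
    using s pqrv off at[of p] at[of q] at[of r]
    by (auto simp: switchable_def V toggled_def)
  moreover have "{x, y} \<in> edges D \<longleftrightarrow> switched_edge D' p q r v x y"
    if "x \<in> verts D" "y \<in> verts D" "x \<noteq> y" for x y
  proof -
    consider "x = v" "y \<noteq> v" | "x \<noteq> v" "y = v" | "x \<noteq> v" "y \<noteq> v" using \<open>x \<noteq> y\<close> by blast
    then show ?thesis
    proof cases
      case 1
      moreover have "{v, y} = {y, v}" by blast
      ultimately show ?thesis
        using that at[of y] tog[of y] by (auto simp: switched_edge_def)
    next
      case 2
      then show ?thesis
        using that at[of x] tog[of x] by (auto simp: switched_edge_def)
    next
      case 3
      then show ?thesis
        using that off[of x y] by (simp add: switched_edge_def)
    qed
  qed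
  ultimately show ?thesis
    by (simp add: switch_related_def V)
qed

text \<open>The squares in Q avoid v and are untouched. A square through v before the switch is used up
  in showing that its vertex commutes with the new generator; a non-edge before the switch gives
  an edge and a square, now in the direction that starts at v.\<close>

lemma (in group) realizes_switched:
  assumes real: "realizes G \<phi> D (Q \<union> switch_squares D p q r v)"
    and sw: "switch_related D D' p q r v"
    and Q: "\<And>a b c d. (a, b, c, d) \<in> Q \<Longrightarrow> v \<notin> {a, b, c, d}"
  shows "realizes G (\<phi>(v := switched (\<phi> p) (\<phi> q) (\<phi> r) (\<phi> v))) D'
    (Q \<union> reverse_quad ` switch_squares D' p q r v)"
proof -
  note real = realizesD[OF real]
  define t where "t = switched (\<phi> p) (\<phi> q) (\<phi> r) (\<phi> v)"
  have s: "switchable D p q r v" and V: "verts D' = verts D"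
    and E: "\<And>x y. x \<in> verts D \<Longrightarrow> y \<in> verts D \<Longrightarrow> x \<noteq> y \<Longrightarrow>
      {x, y} \<in> edges D' \<longleftrightarrow> switched_edge D p q r v x y"
    using sw by (auto simp: switch_related_def)
  have pqrv: "p \<in> verts D" "q \<in> verts D" "r \<in> verts D" "v \<in> verts D" "distinct [p, q, r, v]"
    using s by (auto simp: switchable_def)
  have car: "\<phi> p \<in> carrier G" "\<phi> q \<in> carrier G" "\<phi> r \<in> carrier G" "\<phi> v \<in> carrier G"
    using pqrv real(1) by auto
  have pq: "braids (\<phi> p) (\<phi> q)" and rq: "braids (\<phi> r) (\<phi> q)" and qv: "braids (\<phi> q) (\<phi> v)"
    and pr: "commutes (\<phi> p) (\<phi> r)" and pv: "commutes (\<phi> p) (\<phi> v)" and rv: "commutes (\<phi> r) (\<phi> v)"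
    using s pqrv real(2)[of p q] real(2)[of r q] real(2)[of q v] real(2)[of p r]
      real(2)[of p v] real(2)[of r v] by (auto simp: switchable_def)
  have t: "t \<in> carrier G" "t = switched (\<phi> r) (\<phi> q) (\<phi> p) (\<phi> v)"
    using car pr by (simp_all add: t_def switched_swap[symmetric])
  have off: "{x, y} \<in> edges D' \<longleftrightarrow> {x, y} \<in> edges D"
    if "x \<in> verts D" "y \<in> verts D" "x \<noteq> y" "x \<noteq> v" "y \<noteq> v" for x y
    using E that by (simp add: switched_edge_def)
  have at: "{x, v} \<in> edges D' \<longleftrightarrow> ({x, v} \<in> edges D) \<noteq> toggled D p q r x"
    if "x \<in> verts D" "x \<noteq> v" for x
    using E[of x v] that pqrv by (simp add: switched_edge_def)
  have end_nb: "rel ({x, v} \<in> edges D') (\<phi> x) t \<and>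
      ({x, v} \<in> edges D' \<longrightarrow> cycle_commutes t (\<phi> q) (\<phi> s) (\<phi> x))"
    if x: "x \<in> verts D - {p, q, r, v}" "{x, s} \<in> edges D" and ss: "(s, s') \<in> {(p, r), (r, p)}" for x s s'
  proof -
    have x': "x \<in> verts D" "x \<noteq> p" "x \<noteq> q" "x \<noteq> r" "x \<noteq> v" using x by auto
    have tog: "toggled D p q r x" using x ss by (auto simp: toggled_def)
    have car': "\<phi> x \<in> carrier G" "\<phi> s \<in> carrier G" "\<phi> s' \<in> carrier G"
      using x' real(1) car ss by auto
    have tss: "t = switched (\<phi> s) (\<phi> q) (\<phi> s') (\<phi> v)"
      using ss t by (auto simp: t_def)
    have far: "{x, q} \<notin> edges D" "{x, s'} \<notin> edges D"
      using s x ss by (auto simp: switchable_def)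
    have r1: "commutes (\<phi> x) (\<phi> q)" "commutes (\<phi> x) (\<phi> s')" "braids (\<phi> x) (\<phi> s)"
      using far x x' ss pqrv real(2)[of x q] real(2)[of x s'] real(2)[of x s] by auto
    have r2: "commutes (\<phi> s) (\<phi> s')" "commutes (\<phi> s) (\<phi> v)" "braids (\<phi> s) (\<phi> q)"
      using ss pr pv rv pq rq by (auto simp: rel_sym)
    show ?thesis
    proof (cases "{x, v} \<in> edges D")
      case True
      then have "(x, s, q, v) \<in> switch_squares D p q r v"
        using x ss by (auto simp: switch_squares_def)
      then have "commutes (\<phi> x) (\<phi> s \<triangleright> \<phi> q \<triangleright> \<phi> v)"
        using real(3)[of x s q v] by (simp add: cycle_commutes_def)
      then have "commutes (\<phi> x) t"
        using r1 r2 car car' by (simp add: tss rel_switched_end_neighbour)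
      then show ?thesis using True at x' tog by simp
    next
      case False
      then have "commutes (\<phi> x) (\<phi> v)"
        using real(2)[of x v] x' pqrv by simp
      then have "braids (\<phi> x) t" "cycle_commutes t (\<phi> q) (\<phi> s) (\<phi> x)"
        using r1 r2 qv car car' unfolding tss
        by (auto intro!: braids_switched cycle_commutes_switched)
      then show ?thesis using False at x' tog by simp
    qed
  qed
  have rel_t: "rel ({x, v} \<in> edges D') (\<phi> x) t" if "x \<in> verts D" "x \<noteq> v" for x
  proof -
    consider "x = p" | "x = q" | "x = r" | "x \<notin> {p, q, r}" "{x, p} \<in> edges D"
      | "x \<notin> {p, q, r}" "{x, r} \<in> edges D"
      | "x \<notin> {p, q, r}" "{x, p} \<notin> edges D" "{x, r} \<notin> edges D" by blast
    then show ?thesis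
    proof cases
      case 1
      then show ?thesis
        using commutes_switched_end[OF pq rq pr rv] car at[of p] pqrv s
        by (simp add: t_def toggled_def switchable_def)
    next
      case 2
      then show ?thesis
        using braids_switched_middle[OF pq rq qv pr pv rv] car at[of q] pqrv s
        by (simp add: t_def toggled_def switchable_def)
    next
      case 3
      then show ?thesis
        using commutes_switched_end[OF rq pq _ pv] pr car at[of r] pqrv s
        by (simp add: t(2) toggled_def switchable_def rel_sym)
    next
      case 4
      then show ?thesis using end_nb[of x p r] that by simp
    next
      case 5
      then show ?thesis using end_nb[of x r p] that by simp
    next
      case 6
      then have "{x, q} \<notin> edges D"
        using s that by (auto simp: switchable_def)
      then have "commutes (\<phi> x) (\<phi> p)" "commutes (\<phi> x) (\<phi> q)" "commutes (\<phi> x) (\<phi> r)"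
        using 6 that pqrv real(2)[of x p] real(2)[of x q] real(2)[of x r] by auto
      moreover have "\<phi> x \<in> carrier G" "rel ({x, v} \<in> edges D) (\<phi> x) (\<phi> v)"
        using that real(1)[of x] real(2)[of x v] pqrv by auto
      ultimately show ?thesis
        using car at[of x] that 6 by (simp add: t_def rel_switched_far toggled_def)
    qed
  qed
  have "rel ({x, y} \<in> edges D') ((\<phi>(v := t)) x) ((\<phi>(v := t)) y)"
    if "x \<in> verts D" "y \<in> verts D" "x \<noteq> y" for x y
    using that rel_t[of x] rel_t[of y] off[of x y] real(2)[of x y]
    by (auto simp: rel_sym insert_commute)
  moreover have "cycle_commutes ((\<phi>(v := t)) a) ((\<phi>(v := t)) b) ((\<phi>(v := t)) c) ((\<phi>(v := t)) d)"
    if "(a, b, c, d) \<in> Q" for a b c d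
    using that Q real(3) by auto
  moreover have "cycle_commutes ((\<phi>(v := t)) a) ((\<phi>(v := t)) b) ((\<phi>(v := t)) c) ((\<phi>(v := t)) d)"
    if quad: "(a, b, c, d) \<in> reverse_quad ` switch_squares D' p q r v" for a b c d
  proof -
    obtain z where "z \<in> switch_squares D' p q r v" "(a, b, c, d) = reverse_quad z"
      using quad by blast
    then obtain s where s: "a = v" "b = q" "c = s" "s \<in> {p, r}" "d \<in> verts D - {p, q, r, v}"
      "{d, s} \<in> edges D'" "{d, v} \<in> edges D'"
      by (auto simp: reverse_quad_def switch_squares_def V)
    then have "{d, s} \<in> edges D" using off[of d s] pqrv by auto
    then have "cycle_commutes t (\<phi> q) (\<phi> s) (\<phi> d)"
      using end_nb[of d s r] end_nb[of d s p] s by auto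
    then show ?thesis using s pqrv by auto
  qed
  moreover have "\<phi>(v := t) \<in> verts D \<rightarrow> carrier G"
    using t real(1) by auto
  ultimately show ?thesis
    unfolding realizes_def V t_def[symmetric] by (auto simp del: fun_upd_apply)
qed

lemma switch_squares_quads: "switchable D p q r v \<Longrightarrow> switch_squares D p q r v \<subseteq> quads D"
  by (auto simp: switch_squares_def switchable_def)

text \<open>The inverse translation is obtained by symmetry: pass to inverses, which reverses all
  squares, switch the switched diagram, which gives back the original one, and pass to inverses
  again.\<close>

proposition square_group_switch:
  assumes sw: "switchable D p q r v"
    and Q: "Q \<subseteq> quads D" "\<And>a b c d. (a, b, c, d) \<in> Q \<Longrightarrow> v \<notin> {a, b, c, d}"
  shows "square_group D (Q \<union> switch_squares D p q r v) \<cong>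
    square_group (switch D p q r v)
      (Q \<union> reverse_quad ` switch_squares (switch D p q r v) p q r v)"
proof -
  let ?D' = "switch D p q r v"
  let ?Q = "Q \<union> switch_squares D p q r v"
  let ?Q' = "Q \<union> reverse_quad ` switch_squares ?D' p q r v"
  define w where "w = gen q @ gen p @ gen r @ gen q"
  define f where "f x = (if x = v then winv w @ gen v @ w else gen x)" for x
  define g where "g x = (if x = v then w @ gen v @ winv w else gen x)" for x
  have rel: "switch_related D ?D' p q r v" using sw by (rule switch_related_switch)
  have rel': "switch_related ?D' D p q r v" using rel by (rule switch_related_sym)
  have pqrv: "p \<in> verts D" "q \<in> verts D" "r \<in> verts D" "v \<in> verts D" "distinct [p, q, r, v]"
    using sw by (auto simp: switchable_def)
  have w: "w \<in> words (verts D)" using pqrv by (simp add: w_def)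
  have quads: "?Q \<subseteq> quads D" "?Q' \<subseteq> quads ?D'"
  proof -
    show "?Q \<subseteq> quads D"
      using Q(1) switch_squares_quads[OF sw] by blast
    have "switchable ?D' p q r v"
      using rel' by (simp add: switch_related_def)
    then have "reverse_quad ` switch_squares ?D' p q r v \<subseteq> quads ?D'"
      by (intro reverse_quad_quads switch_squares_quads)
    then show "?Q' \<subseteq> quads ?D'" using Q(1) by auto
  qed
  have eval_f: "eval G \<phi> (f x) = (if x = v
      then inv\<^bsub>G\<^esub> (eval G \<phi> w) \<otimes>\<^bsub>G\<^esub> \<phi> v \<otimes>\<^bsub>G\<^esub> eval G \<phi> w else \<phi> x)"
    and eval_g: "eval G \<phi> (g x) = (if x = v
      then eval G \<phi> w \<otimes>\<^bsub>G\<^esub> \<phi> v \<otimes>\<^bsub>G\<^esub> inv\<^bsub>G\<^esub> (eval G \<phi> w) else \<phi> x)"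
    if "group G" "\<phi> \<in> verts D \<rightarrow> carrier G" "x \<in> verts D" for G :: "'a word set monoid" and \<phi> x
  proof -
    interpret group G by fact
    have "\<phi> v \<in> carrier G" "\<phi> x \<in> carrier G" "eval G \<phi> w \<in> carrier G"
      using that pqrv w by auto
    then show "eval G \<phi> (f x) = (if x = v
      then inv\<^bsub>G\<^esub> (eval G \<phi> w) \<otimes>\<^bsub>G\<^esub> \<phi> v \<otimes>\<^bsub>G\<^esub> eval G \<phi> w else \<phi> x)"
      "eval G \<phi> (g x) = (if x = v
      then eval G \<phi> w \<otimes>\<^bsub>G\<^esub> \<phi> v \<otimes>\<^bsub>G\<^esub> inv\<^bsub>G\<^esub> (eval G \<phi> w) else \<phi> x)"
      using that pqrv w
      by (simp_all add: f_def g_def eval_append[OF that(2)] eval_winv[OF that(2)] eval_gen m_assoc)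
  qed
  have eval_w: "eval G \<psi> w = eval G \<phi> w"
    if "\<And>x. x \<in> verts D - {v} \<Longrightarrow> \<psi> x = \<phi> x" for G :: "'a word set monoid" and \<phi> \<psi>
    using that pqrv by (intro eval_cong[where S = "verts D - {v}"]) (auto simp: w_def)
  show ?thesis
  proof (rule square_group_iso[where f = f and g = g])
    fix G :: "'a word set monoid" and \<phi>
    assume "group G" and r: "realizes G \<phi> ?D' ?Q'"
    then interpret group G by simp
    have car: "\<phi> \<in> verts D \<rightarrow> carrier G" "\<And>x. x \<in> verts D \<Longrightarrow> \<phi> x \<in> carrier G"
      using realizesD(1)[OF r] by auto
    define \<psi> where "\<psi> = (\<lambda>x. inv\<^bsub>G\<^esub> (\<phi> x))"
    (* Undoing the conjugation by qprq meets the letters p and r in the opposite order. *)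
    have "{p, r} \<notin> edges ?D'"
      using rel' by (simp add: switch_related_def switchable_def)
    then have "commutes (\<psi> p) (\<psi> r)"
      using realizesD(2)[OF r, of p r] pqrv car by (simp add: \<psi>_def)
    then have swap: "switched (\<psi> p) (\<psi> q) (\<psi> r) (\<psi> v) = switched (\<psi> r) (\<psi> q) (\<psi> p) (\<psi> v)"
      using pqrv car by (intro switched_swap) (auto simp: \<psi>_def)
    have "realizes G \<psi> ?D' (reverse_quad ` Q \<union> switch_squares ?D' p q r v)"
      using realizes_inv[OF r quads(2)] by (simp add: \<psi>_def image_Un)
    then have "realizes G (\<psi>(v := switched (\<psi> p) (\<psi> q) (\<psi> r) (\<psi> v))) D
        (reverse_quad ` Q \<union> reverse_quad ` switch_squares D p q r v)"
      using rel' by (rule realizes_switched) (use Q(2) in \<open>auto simp: reverse_quad_def\<close>)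
    then have "realizes G (\<lambda>x. inv\<^bsub>G\<^esub> ((\<psi>(v := switched (\<psi> p) (\<psi> q) (\<psi> r) (\<psi> v))) x)) D ?Q"
      using realizes_inv[where Q = "reverse_quad ` ?Q" and D = D]
        reverse_quad_quads[OF quads(1)] by (simp add: image_Un del: fun_upd_apply)
    moreover have "eval G \<phi> (f x) = inv\<^bsub>G\<^esub> ((\<psi>(v := switched (\<psi> p) (\<psi> q) (\<psi> r) (\<psi> v))) x)"
      if "x \<in> verts D" for x
      using that pqrv car eval_f[OF \<open>group G\<close> car(1) that] unfolding swap
      by (auto simp: \<psi>_def switched_def conj_def w_def gen_def inv_mult_group m_assoc)
    ultimately show "realizes G (\<lambda>x. eval G \<phi> (f x)) D ?Q"
      using quads(1) by (subst realizes_cong) auto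
  next
    fix G :: "'a word set monoid" and \<phi>
    assume "group G" and r: "realizes G \<phi> D ?Q"
    then interpret group G by simp
    have car: "\<phi> \<in> verts D \<rightarrow> carrier G" "\<And>x. x \<in> verts D \<Longrightarrow> \<phi> x \<in> carrier G"
      using realizesD(1)[OF r] by auto
    have "realizes G (\<phi>(v := switched (\<phi> p) (\<phi> q) (\<phi> r) (\<phi> v))) ?D' ?Q'"
      using realizes_switched[OF r rel] Q(2) by blast
    moreover have "eval G \<phi> (g x) = (\<phi>(v := switched (\<phi> p) (\<phi> q) (\<phi> r) (\<phi> v))) x"
      if "x \<in> verts D" for x
      using that pqrv car eval_g[OF \<open>group G\<close> car(1) that]
      by (auto simp: switched_def conj_def w_def gen_def inv_mult_group m_assoc)
    ultimately show "realizes G (\<lambda>x. eval G \<phi> (g x)) ?D' ?Q'"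
      using quads(2) by (subst realizes_cong) auto
  next
    fix G :: "'a word set monoid" and \<phi> x
    assume G: "group G" "\<phi> \<in> verts D \<rightarrow> carrier G" "x \<in> verts D"
    then interpret group G by simp
    have "\<phi> v \<in> carrier G" "eval G \<phi> w \<in> carrier G"
      using G pqrv w by auto
    moreover have "(\<lambda>y. eval G \<phi> (g y)) \<in> verts D \<rightarrow> carrier G"
      using G w pqrv by (auto simp: g_def intro!: eval_closed)
    ultimately show "eval G (\<lambda>y. eval G \<phi> (g y)) (f x) = \<phi> x"
      using G pqrv eval_w[of "\<lambda>y. eval G \<phi> (g y)" \<phi> G]
      by (simp add: eval_f eval_g m_assoc)
  next
    fix G :: "'a word set monoid" and \<phi> x
    assume "group G" "\<phi> \<in> verts ?D' \<rightarrow> carrier G" "x \<in> verts ?D'"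
    then have G: "group G" "\<phi> \<in> verts D \<rightarrow> carrier G" "x \<in> verts D" by simp_all
    then interpret group G by simp
    have "\<phi> v \<in> carrier G" "eval G \<phi> w \<in> carrier G"
      using G pqrv w by auto
    moreover have "(\<lambda>y. eval G \<phi> (f y)) \<in> verts D \<rightarrow> carrier G"
      using G w pqrv by (auto simp: f_def intro!: eval_closed)
    ultimately show "eval G (\<lambda>y. eval G \<phi> (f y)) (g x) = \<phi> x"
      using G pqrv eval_w[of "\<lambda>y. eval G \<phi> (f y)" \<phi> G]
      by (simp add: eval_f eval_g m_assoc)
  qed (use quads w pqrv in \<open>auto simp: f_def g_def\<close>)
qed

text \<open>The squares created by a switch, described in the diagram before the switch.\<close>

definition new_squares :: "'v diagram \<Rightarrow> 'v \<Rightarrow> 'v \<Rightarrow> 'v \<Rightarrow> 'v \<Rightarrow> 'v quad set" where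
  "new_squares D p q r v = {(v, q, s, x) | x s. s \<in> {p, r} \<and> x \<in> verts D - {p, q, r, v} \<and>
     {x, s} \<in> edges D \<and> {x, v} \<notin> edges D}"

lemma reverse_switch_squares_switch:
  assumes "switchable D p q r v"
  shows "reverse_quad ` switch_squares (switch D p q r v) p q r v = new_squares D p q r v"
proof -
  have "{x, s} \<in> edges (switch D p q r v) \<and> {x, v} \<in> edges (switch D p q r v) \<longleftrightarrow>
      {x, s} \<in> edges D \<and> {x, v} \<notin> edges D"
    if "s \<in> {p, r}" "x \<in> verts D - {p, q, r, v}" for x s
    using that assms
    by (auto simp: switch_edges_iff switchable_def switched_edge_def toggled_def)
  then have "switch_squares (switch D p q r v) p q r v = {(x, s, q, v) | x s. s \<in> {p, r} \<and>
      x \<in> verts D - {p, q, r, v} \<and> {x, s} \<in> edges D \<and> {x, v} \<notin> edges D}"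
    unfolding switch_squares_def by auto
  moreover have "reverse_quad ` {(x, s, q, v) | x s. \<Phi> x s} = {reverse_quad (x, s, q, v) | x s. \<Phi> x s}" for \<Phi>
    by blast
  ultimately show ?thesis
    by (simp add: reverse_quad_def new_squares_def)
qed

text \<open>The following two forms of the sets of squares can be evaluated by rewriting when the
  diagram is given by explicit finite sets.\<close>

lemma switch_squares_enum:
  "switch_squares D p q r v = (\<Union>x\<in>verts D. \<Union>s\<in>{p, r}.
     if x \<notin> {p, q, r, v} \<and> {x, s} \<in> edges D \<and> {x, v} \<in> edges D then {(x, s, q, v)} else {})"
  by (auto simp: switch_squares_def split: if_splits)

lemma new_squares_enum:
  "new_squares D p q r v = (\<Union>x\<in>verts D. \<Union>s\<in>{p, r}.
     if x \<notin> {p, q, r, v} \<and> {x, s} \<in> edges D \<and> {x, v} \<notin> edges D then {(v, q, s, x)} else {})"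
  by (auto simp: new_squares_def split: if_splits)

text \<open>A switch followed by a renaming of the vertices, with hypotheses that are finite checks for
  explicit diagrams: P lists the squares before the switch, P' those after it.\<close>

proposition square_group_switch_relabel:
  assumes sw: "switchable D p q r v"
    and Q: "\<forall>(a, b, c, d)\<in>Q. {a, b, c, d} \<subseteq> verts D - {v}"
    and before: "Q \<union> switch_squares D p q r v = P"
    and after: "Q \<union> new_squares D p q r v = P'"
    and bij: "bij_betw \<sigma> (verts D) (verts D')"
    and edges: "\<forall>x\<in>verts D. \<forall>y\<in>verts D. x \<noteq> y \<longrightarrow>
      ({\<sigma> x, \<sigma> y} \<in> edges D' \<longleftrightarrow> switched_edge D p q r v x y)"
    and Q': "Q' \<subseteq> induced_squares D'"
    and sq: "map_quad \<sigma> ` P' \<subseteq> (\<Union>q\<in>Q'. rotations q)"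
            "Q' \<subseteq> (\<Union>q\<in>P'. rotations (map_quad \<sigma> q))"
  shows "square_group D P \<cong> square_group D' Q'"
proof -
  have P': "P' = Q \<union> reverse_quad ` switch_squares (switch D p q r v) p q r v"
    using after sw by (simp add: reverse_switch_squares_switch)
  have quads: "Q \<subseteq> quads D"
  proof
    fix z assume "z \<in> Q"
    moreover obtain a b c d where "z = (a, b, c, d)" by (cases z)
    ultimately show "z \<in> quads D" using bspec[OF Q, of z] by simp
  qed
  have avoid: "v \<notin> {a, b, c, d}" if "(a, b, c, d) \<in> Q" for a b c d
    using bspec[OF Q that] by auto
  from P' have "square_group D P \<cong> square_group (switch D p q r v) P'"
    using square_group_switch[OF sw quads avoid] before by simp
  moreover have "square_group (switch D p q r v) P' \<cong> square_group D' Q'"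
  proof (rule square_group_relabel)
    show "bij_betw \<sigma> (verts (switch D p q r v)) (verts D')" using bij by simp
    show "P' \<subseteq> quads (switch D p q r v)"
      using quads sw after by (auto simp: switchable_def new_squares_def)
  qed (use edges Q' sq in \<open>simp_all add: switch_edges_iff\<close>)
  ultimately show ?thesis by (rule iso_trans)
qed

section \<open>Orientations\<close>

lemma rotations_sym: "q \<in> rotations q' \<longleftrightarrow> q' \<in> rotations q"
  by (cases q; cases q') (auto simp: rotations_def)

lemma reverse_quad_rotations: "reverse_quad q \<in> rotations q' \<longleftrightarrow> q \<in> rotations (reverse_quad q')"
  by (cases q; cases q') (auto simp: rotations_def reverse_quad_def)

lemma reverse_quad_induced:
  "q \<in> induced_squares D \<Longrightarrow> reverse_quad q \<in> induced_squares D"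
  by (cases q) (auto simp: reverse_quad_def induced_squares_def insert_commute)

lemma oriented_rotations:
  "q' \<in> rotations q \<Longrightarrow> q \<in> oriented_four_cycles A \<Longrightarrow> q' \<in> oriented_four_cycles A"
  by (auto simp: rotations_def oriented_four_cycles_def)

lemma orientation_asym:
  assumes "is_orientation D A" "(x, y) \<in> A"
  shows "(y, x) \<notin> A"
proof -
  have "{x, y} \<in> edges D"
    using assms unfolding is_orientation_def by auto
  then show ?thesis
    using assms unfolding is_orientation_def by meson
qed

lemma oriented_not_reversed:
  assumes "is_orientation D A" "q \<in> oriented_four_cycles A"
  shows "reverse_quad q \<notin> oriented_four_cycles A"
  using assms unfolding is_orientation_def oriented_four_cycles_def reverse_quad_def by fastforce

lemma oriented_imp_four_cycle:
  assumes "is_orientation D A" "q \<in> oriented_four_cycles A"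
  shows "q \<in> four_cycles D"
  using assms unfolding is_orientation_def oriented_four_cycles_def four_cycles_def by fastforce

text \<open>If the chosen squares Q are directed along the orientation, then the transversal T and Q
  consist of the same oriented four-cycles up to rotation.\<close>

lemma square_group_transversal:
  assumes A: "is_orientation D A" and T: "is_cycle_transversal A T"
    and Q: "Q \<subseteq> induced_squares D" "Q \<subseteq> oriented_four_cycles A"
    and cover: "four_cycles D \<subseteq> (\<Union>q\<in>Q. rotations q \<union> rotations (reverse_quad q))"
  shows "square_group D T \<cong> square_group D Q"
proof -
  have T_Q: "\<exists>q\<in>Q. t \<in> rotations q" if "t \<in> T" for t
  proof -
    have t: "t \<in> oriented_four_cycles A"
      using T that by (auto simp: is_cycle_transversal_def)
    then obtain q where q: "q \<in> Q" "t \<in> rotations q \<or> t \<in> rotations (reverse_quad q)"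
      using oriented_imp_four_cycle[OF A] cover by blast
    have "t \<notin> rotations (reverse_quad q)"
      using oriented_rotations[of "reverse_quad t" q A] oriented_not_reversed[OF A t] Q(2) q(1)
        reverse_quad_rotations by blast
    with q show ?thesis by blast
  qed
  have Q_T: "\<exists>t\<in>T. q \<in> rotations t" if "q \<in> Q" for q
    using T Q(2) that rotations_sym unfolding is_cycle_transversal_def by blast
  have "T \<subseteq> induced_squares D"
    using T_Q Q(1) rotations_induced by blast
  then show ?thesis
    using T_Q Q_T Q(1) by (intro square_group_rotations) auto
qed

proposition square_group_oriented:
  assumes A: "is_orientation D A" and T: "is_cycle_transversal A T"
    and Q: "Q \<subseteq> induced_squares D"
    and coherent: "Q \<subseteq> oriented_four_cycles A \<or> reverse_quad ` Q \<subseteq> oriented_four_cycles A"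
    and cover: "four_cycles D \<subseteq> (\<Union>q\<in>Q. rotations q \<union> rotations (reverse_quad q))"
  shows "square_group D T \<cong> square_group D Q"
  using coherent
proof
  assume "Q \<subseteq> oriented_four_cycles A"
  then show ?thesis using square_group_transversal[OF A T Q] cover by blast
next
  assume "reverse_quad ` Q \<subseteq> oriented_four_cycles A"
  moreover have "reverse_quad ` Q \<subseteq> induced_squares D"
    using Q reverse_quad_induced by blast
  moreover have "four_cycles D \<subseteq> (\<Union>q\<in>reverse_quad ` Q. rotations q \<union> rotations (reverse_quad q))"
    using cover by auto
  ultimately have "square_group D T \<cong> square_group D (reverse_quad ` Q)"
    using square_group_transversal[OF A T] by blast
  also have "\<dots> \<cong> square_group D (reverse_quad ` reverse_quad ` Q)"
    using Q induced_squares_quads by (intro square_group_reverse reverse_quad_quads) blast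
  finally (iso_trans) show ?thesis by simp
qed

section \<open>Ladders\<close>

text \<open>A subgraph of the infinite ladder with rails B i and C i. A four-cycle of such a graph
  consists of two consecutive rungs and the rail edges between them, which replaces a search
  through all quadruples of vertices.\<close>

definition ladder :: "vertex diagram \<Rightarrow> bool" where
  "ladder D \<longleftrightarrow> (\<forall>e\<in>edges D. \<exists>i. e = {B i, B (i + 1)} \<or> e = {C i, C (i + 1)} \<or> e = {B i, C i})"

definition rung :: "vertex diagram \<Rightarrow> int \<Rightarrow> bool" where
  "rung D i \<longleftrightarrow> {B i, C i} \<in> edges D"

lemma ladder_edge:
  assumes "ladder D"
  shows "{B i, B j} \<in> edges D \<Longrightarrow> j = i + 1 \<or> i = j + 1"
    and "{C i, C j} \<in> edges D \<Longrightarrow> j = i + 1 \<or> i = j + 1"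
    and "{B i, C j} \<in> edges D \<Longrightarrow> j = i \<and> rung D i"
    and "{C i, B j} \<in> edges D \<Longrightarrow> j = i \<and> rung D i"
  using assms unfolding ladder_def rung_def by (fastforce simp: doubleton_eq_iff)+

definition ladder_square :: "int \<Rightarrow> vertex quad" where
  "ladder_square i = (C i, B i, B (i + 1), C (i + 1))"

lemma ladder_four_cycle:
  assumes "ladder D" "q \<in> four_cycles D"
  shows "\<exists>i. rung D i \<and> rung D (i + 1) \<and>
    (q \<in> rotations (ladder_square i) \<or> q \<in> rotations (reverse_quad (ladder_square i)))"
proof -
  obtain a b c d where abcd: "q = (a, b, c, d)" by (cases q)
  then have "{a, b} \<in> edges D" "{b, c} \<in> edges D" "{c, d} \<in> edges D" "{d, a} \<in> edges D"
    "a \<noteq> c" "b \<noteq> d" using assms(2) by (auto simp: four_cycles_def)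
  then show ?thesis
    by (cases a; cases b; cases c; cases d)
      (auto simp: abcd rotations_def reverse_quad_def ladder_square_def
        dest!: ladder_edge[OF assms(1)])
qed

section \<open>The Carter diagrams of type E\<close>

lemma coxeter_E_edge_iff:
  "{i, j} \<in> edges (coxeter_E n) \<longleftrightarrow> {i, j} = {1, 3} \<or> {i, j} = {2, 4} \<or>
     3 \<le> i \<and> i < n \<and> j = i + 1 \<or> 3 \<le> j \<and> j < n \<and> i = j + 1"
  by (auto simp: coxeter_E_def doubleton_eq_iff)

lemma verts_coxeter_E:
  "verts (coxeter_E 6) = {1, 2, 3, 4, 5, 6}"
  "verts (coxeter_E 7) = {1, 2, 3, 4, 5, 6, 7}"
  "verts (coxeter_E 8) = {1, 2, 3, 4, 5, 6, 7, 8}"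
  by (auto simp: coxeter_E_def)

lemmas carter_defs = E6_a1_def E6_a2_def E7_a1_def E7_a2_def E7_a3_def E8_a1_def E8_a2_def
  E8_a3_def E8_a4_def E8_a5_def E8_a6_def extend_def

text \<open>The squares of the Carter diagrams, from left to right in the ladder. Neighbouring ones
  traverse their common rung in the same direction. The first two are written in the form in which
  they occur when C 1 is switched along B 0 - B 1 - B 2.\<close>

abbreviation "square1 \<equiv> (C 0, B 0, B 1, C 1)"
abbreviation "square2 \<equiv> (C 2, B 2, B 1, C 1)"
abbreviation "square3 \<equiv> (C 2, B 2, B 3, C 3)"

lemma verts_carter:
  "verts E6_a1 = {B 0, B 1, B 2, C 0, C 1, C 2}"
  "verts E6_a2 = {B 0, B 1, B 2, C 0, C 1, C 2}"
  "verts E7_a1 = {B 0, B 1, B 2, C 0, C 1, C 2, C 3}"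
  "verts E7_a2 = {B 0, B 1, B 2, C 0, C 1, C 2, C (-1)}"
  "verts E7_a3 = {B 0, B 1, B 2, C 0, C 1, C 2, C 3}"
  "verts E8_a1 = {B 0, B 1, B 2, C 0, C 1, C 2, C 3, C 4}"
  "verts E8_a2 = {B 0, B 1, B 2, C 0, C 1, C 2, C 3, B (-1)}"
  "verts E8_a3 = {B 0, B 1, B 2, C 0, C 1, C 2, C (-1), B (-1)}"
  "verts E8_a4 = {B 0, B 1, B 2, C 0, C 1, C 2, C 3, C 4}"
  "verts E8_a5 = {B 0, B 1, B 2, C 0, C 1, C 2, C 3, B (-1)}"
  "verts E8_a6 = {B 0, B 1, B 2, C 0, C 1, C 2, C 3, B 3}"
  by (auto simp: carter_defs)

lemma edges_carter:
  "edges E6_a1 = {{B 0, B 1}, {B 1, B 2}, {C 0, C 1}, {C 1, C 2}, {B 0, C 0}, {B 1, C 1}}"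
  "edges E6_a2 = {{B 0, B 1}, {B 1, B 2}, {C 0, C 1}, {C 1, C 2}, {B 0, C 0}, {B 1, C 1},
    {B 2, C 2}}"
  "edges E7_a1 = {{B 0, B 1}, {B 1, B 2}, {C 0, C 1}, {C 1, C 2}, {B 0, C 0}, {B 1, C 1},
    {C 2, C 3}}"
  "edges E7_a2 = {{B 0, B 1}, {B 1, B 2}, {C 0, C 1}, {C 1, C 2}, {B 0, C 0}, {B 1, C 1},
    {C (-1), C 0}}"
  "edges E7_a3 = {{B 0, B 1}, {B 1, B 2}, {C 0, C 1}, {C 1, C 2}, {B 0, C 0}, {B 1, C 1},
    {B 2, C 2}, {C 2, C 3}}"
  "edges E8_a1 = {{B 0, B 1}, {B 1, B 2}, {C 0, C 1}, {C 1, C 2}, {B 0, C 0}, {B 1, C 1},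
    {C 2, C 3}, {C 3, C 4}}"
  "edges E8_a2 = {{B 0, B 1}, {B 1, B 2}, {C 0, C 1}, {C 1, C 2}, {B 0, C 0}, {B 1, C 1},
    {C 2, C 3}, {B (-1), B 0}}"
  "edges E8_a3 = {{B 0, B 1}, {B 1, B 2}, {C 0, C 1}, {C 1, C 2}, {B 0, C 0}, {B 1, C 1},
    {C (-1), C 0}, {B (-1), B 0}}"
  "edges E8_a4 = {{B 0, B 1}, {B 1, B 2}, {C 0, C 1}, {C 1, C 2}, {B 0, C 0}, {B 1, C 1},
    {B 2, C 2}, {C 2, C 3}, {C 3, C 4}}"
  "edges E8_a5 = {{B 0, B 1}, {B 1, B 2}, {C 0, C 1}, {C 1, C 2}, {B 0, C 0}, {B 1, C 1},
    {B 2, C 2}, {C 2, C 3}, {B (-1), B 0}}"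
  "edges E8_a6 = {{B 0, B 1}, {B 1, B 2}, {C 0, C 1}, {C 1, C 2}, {B 0, C 0}, {B 1, C 1},
    {B 2, C 2}, {C 2, C 3}, {B 2, B 3}, {B 3, C 3}}"
  by (auto simp: carter_defs)

text \<open>Sets of vertices and edges are expanded first, so that the simplifier then meets only
  statements about explicitly given vertices; with variable vertices the many edges would lead to
  an explosion of cases.\<close>

lemmas diagram_unfold = switchable_def switch_squares_enum new_squares_enum bij_betw_def
  switched_edge_def toggled_def coxeter_E_edge_iff verts_coxeter_E verts_carter edges_carter
  ball_simps UN_insert UN_empty
lemmas diagram_simps = verts_carter edges_carter doubleton_eq_iff insert_commute rotations_def
  map_quad_def induced_squares_def reverse_quad_def

text \<open>In these seven diagrams the switch of C 1 along B 0 - B 1 - B 2 uses up every square and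
  creates none. The renamings send the result to the Bourbaki numbering of the Coxeter diagram;
  the default value 0 is not the image of any vertex.\<close>

lemma E6_a1_iso:
  "square_group E6_a1 {square1} \<cong> square_group (coxeter_E 6) {}"
  by (rule square_group_switch_relabel[where p = "B 0" and q = "B 1" and r = "B 2"
        and v = "C 1" and Q = "{}" and P' = "{}"
        and \<sigma> = "(\<lambda>_. 0)(C 0 := 1, B 2 := 2, B 0 := 3, B 1 := 4,
          C 1 := 5, C 2 := 6)"];
    (unfold diagram_unfold)?; simp add: diagram_simps; auto)

lemma E6_a2_iso:
  "square_group E6_a2 {square1, square2} \<cong> square_group (coxeter_E 6) {}"
  by (rule square_group_switch_relabel[where p = "B 0" and q = "B 1" and r = "B 2"
        and v = "C 1" and Q = "{}" and P' = "{}"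
        and \<sigma> = "(\<lambda>_. 0)(C 0 := 1, C 1 := 2, B 0 := 3, B 1 := 4,
          B 2 := 5, C 2 := 6)"];
    (unfold diagram_unfold)?; simp add: diagram_simps; auto)

lemma E7_a1_iso:
  "square_group E7_a1 {square1} \<cong> square_group (coxeter_E 7) {}"
  by (rule square_group_switch_relabel[where p = "B 0" and q = "B 1" and r = "B 2"
        and v = "C 1" and Q = "{}" and P' = "{}"
        and \<sigma> = "(\<lambda>_. 0)(C 0 := 1, B 2 := 2, B 0 := 3, B 1 := 4,
          C 1 := 5, C 2 := 6, C 3 := 7)"];
    (unfold diagram_unfold)?; simp add: diagram_simps; auto)

lemma E7_a2_iso:
  "square_group E7_a2 {square1} \<cong> square_group (coxeter_E 7) {}"
  by (rule square_group_switch_relabel[where p = "B 0" and q = "B 1" and r = "B 2"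
        and v = "C 1" and Q = "{}" and P' = "{}"
        and \<sigma> = "(\<lambda>_. 0)(C 2 := 1, B 2 := 2, C 1 := 3, B 1 := 4,
          B 0 := 5, C 0 := 6, C (-1) := 7)"];
    (unfold diagram_unfold)?; simp add: diagram_simps; auto)

lemma E7_a3_iso:
  "square_group E7_a3 {square1, square2} \<cong> square_group (coxeter_E 7) {}"
  by (rule square_group_switch_relabel[where p = "B 0" and q = "B 1" and r = "B 2"
        and v = "C 1" and Q = "{}" and P' = "{}"
        and \<sigma> = "(\<lambda>_. 0)(C 0 := 1, C 1 := 2, B 0 := 3, B 1 := 4,
          B 2 := 5, C 2 := 6, C 3 := 7)"];
    (unfold diagram_unfold)?; simp add: diagram_simps; auto)

lemma E8_a1_iso:
  "square_group E8_a1 {square1} \<cong> square_group (coxeter_E 8) {}"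
  by (rule square_group_switch_relabel[where p = "B 0" and q = "B 1" and r = "B 2"
        and v = "C 1" and Q = "{}" and P' = "{}"
        and \<sigma> = "(\<lambda>_. 0)(C 0 := 1, B 2 := 2, B 0 := 3, B 1 := 4,
          C 1 := 5, C 2 := 6, C 3 := 7, C 4 := 8)"];
    (unfold diagram_unfold)?; simp add: diagram_simps; auto)

lemma E8_a4_iso:
  "square_group E8_a4 {square1, square2} \<cong> square_group (coxeter_E 8) {}"
  by (rule square_group_switch_relabel[where p = "B 0" and q = "B 1" and r = "B 2"
        and v = "C 1" and Q = "{}" and P' = "{}"
        and \<sigma> = "(\<lambda>_. 0)(C 0 := 1, C 1 := 2, B 0 := 3, B 1 := 4,
          B 2 := 5, C 2 := 6, C 3 := 7, C 4 := 8)"];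
    (unfold diagram_unfold)?; simp add: diagram_simps; auto)

text \<open>Here B (-1) would become joined to C 1 by the previous switch. The path C 0 - B 0 - B (-1)
  leads directly to E8 instead.\<close>

lemma E8_a2_switch:
  "square_group E8_a2 {(C 1, C 0, B 0, B 1)} \<cong> square_group (coxeter_E 8) {}"
  by (rule square_group_switch_relabel[where p = "C 0" and q = "B 0" and r = "B (-1)"
        and v = "B 1" and Q = "{}" and P' = "{}"
        and \<sigma> = "(\<lambda>_. 0)(B 2 := 1, B (-1) := 2, B 1 := 3,
          B 0 := 4, C 0 := 5, C 1 := 6, C 2 := 7, C 3 := 8)"];
    (unfold diagram_unfold)?; simp add: diagram_simps; auto)

text \<open>In E8(a3), E8(a5) and E8(a6) the switch of C 1 along B 0 - B 1 - B 2 also creates one new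
  square, through the neighbour B (-1) or B 3 of an end of the path, and the result is another
  Carter diagram. For E8(a5) and E8(a6) its squares come out with the reversed direction.\<close>

lemma E8_a3_switch:
  "square_group E8_a3 {square1} \<cong> square_group E8_a2 {square1}"
  by (rule square_group_switch_relabel[where p = "B 0" and q = "B 1" and r = "B 2"
        and v = "C 1" and Q = "{}" and P' = "{(C 1, B 1, B 0, B (-1))}"
        and \<sigma> = "(\<lambda>_. B 0)(B (-1) := C 0, C 1 := B 0,
          C 2 := B (-1), B 1 := B 1, B 2 := B 2, B 0 := C 1, C 0 := C 2, C (-1) := C 3)"];
    (unfold diagram_unfold)?; simp add: diagram_simps; auto)

lemma E8_a5_switch:
  "square_group E8_a5 {square1, square2} \<cong> square_group E8_a1 {reverse_quad square1}"
  by (rule square_group_switch_relabel[where p = "B 0" and q = "B 1" and r = "B 2"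
        and v = "C 1" and Q = "{}" and P' = "{(C 1, B 1, B 0, B (-1))}"
        and \<sigma> = "(\<lambda>_. B 0)(B 0 := B 1, C 0 := B 2, B 1 := C 1,
          B 2 := C 2, C 2 := C 3, C 3 := C 4, C 1 := C 0, B (-1) := B 0)"];
    (unfold diagram_unfold)?; simp add: diagram_simps; auto)

lemma E8_a6_switch:
  "square_group E8_a6 {square1, square2, square3} \<cong>
    square_group E8_a4 {reverse_quad square1, reverse_quad square2}"
  by (rule square_group_switch_relabel[where p = "B 0" and q = "B 1" and r = "B 2"
        and v = "C 1" and Q = "{square3}" and P' = "{square3, (C 1, B 1, B 2, B 3)}"
        and \<sigma> = "(\<lambda>_. B 0)(B 1 := C 2, B 0 := C 3, C 0 := C 4,
          C 1 := B 2, B 2 := C 1, B 3 := B 1, C 2 := C 0, C 3 := B 0)"];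
    (unfold diagram_unfold)?; simp add: diagram_simps; auto)

lemma E8_a2_iso:
  "square_group E8_a2 {square1} \<cong> square_group (coxeter_E 8) {}"
proof -
  have "square_group E8_a2 {square1} \<cong> square_group E8_a2 {(C 1, C 0, B 0, B 1)}"
    by (rule square_group_rotations) (simp_all add: diagram_simps)
  then show ?thesis using E8_a2_switch by (rule iso_trans)
qed

lemma E8_a3_iso:
  "square_group E8_a3 {square1} \<cong> square_group (coxeter_E 8) {}"
  using E8_a3_switch E8_a2_iso by (rule iso_trans)

lemma E8_a5_iso:
  "square_group E8_a5 {square1, square2} \<cong> square_group (coxeter_E 8) {}"
proof -
  have "square_group E8_a1 {reverse_quad square1} \<cong> square_group (coxeter_E 8) {}"
    using square_group_unreverse[OF E8_a1_iso]
    by (simp add: diagram_simps)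
  with E8_a5_switch show ?thesis by (rule iso_trans)
qed

lemma E8_a6_iso:
  "square_group E8_a6 {square1, square2, square3} \<cong> square_group (coxeter_E 8) {}"
proof -
  have "square_group E8_a4 {reverse_quad square1, reverse_quad square2} \<cong> square_group (coxeter_E 8) {}"
    using square_group_unreverse[OF E8_a4_iso]
    by (simp add: diagram_simps)
  with E8_a6_switch show ?thesis by (rule iso_trans)
qed

text \<open>Consecutive squares share a rung, so if one of them follows the orientation, so does the
  next. Hence all chosen squares follow it, or all their reverses do.\<close>

lemma ladder_oriented:
  assumes A: "is_orientation D A" "four_cycles_oriented D A" "is_cycle_transversal A T"
    and D: "ladder D" "Q \<subseteq> induced_squares D"
    and Q: "Q \<in> {{square1}, {square1, square2}, {square1, square2, square3}}"
    and rungs: "\<And>i. rung D i \<Longrightarrow> rung D (i + 1) \<Longrightarrow>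
      i = 0 \<or> i = 1 \<and> square2 \<in> Q \<or> i = 2 \<and> square3 \<in> Q"
  shows "square_group D T \<cong> square_group D Q"
proof (rule square_group_oriented[OF A(1,3) D(2)])
  have cyc: "Q \<subseteq> four_cycles D"
    using D(2) by (auto simp: induced_squares_def four_cycles_def)
  have or: "q \<in> oriented_four_cycles A \<or> reverse_quad q \<in> oriented_four_cycles A" if "q \<in> Q" for q
  proof -
    have "q \<in> four_cycles D" using cyc that by blast
    then show ?thesis
      using bspec[OF A(2)[unfolded four_cycles_oriented_def]]
      by (cases q) (fastforce simp: reverse_quad_def)
  qed
  let ?O = "oriented_four_cycles A"
  have arrow: "(y, x) \<notin> A" if "(x, y) \<in> A" for x y
    using A(1) that by (rule orientation_asym)
  have one: "square1 \<in> Q" using Q by auto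
  have two: "square1 \<in> ?O \<longleftrightarrow> square2 \<in> ?O" if "square2 \<in> Q"
    using or[OF one] or[OF that] arrow[of "B 1" "C 1"]
    by (auto simp: oriented_four_cycles_def reverse_quad_def)
  have three: "square2 \<in> ?O \<longleftrightarrow> square3 \<in> ?O" if "square2 \<in> Q" "square3 \<in> Q"
    using or[OF that(1)] or[OF that(2)] arrow[of "C 2" "B 2"]
    by (auto simp: oriented_four_cycles_def reverse_quad_def)
  have "q \<in> ?O \<longleftrightarrow> square1 \<in> ?O" if "q \<in> Q" for q
    using Q that two three by auto
  then show "Q \<subseteq> ?O \<or> reverse_quad ` Q \<subseteq> ?O"
    using or by blast
  show "four_cycles D \<subseteq> (\<Union>q\<in>Q. rotations q \<union> rotations (reverse_quad q))"
  proof
    fix q assume "q \<in> four_cycles D"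
    then obtain i where i: "rung D i" "rung D (i + 1)"
      "q \<in> rotations (ladder_square i) \<or> q \<in> rotations (reverse_quad (ladder_square i))"
      using ladder_four_cycle[OF D(1)] by blast
    consider "i = 0" | "i = 1" "square2 \<in> Q" | "i = 2" "square3 \<in> Q" using rungs i by blast
    then obtain s where "s \<in> Q" "ladder_square i = s \<or> ladder_square i = reverse_quad s"
      using Q by cases (auto simp: ladder_square_def reverse_quad_def)
    then show "q \<in> (\<Union>q\<in>Q. rotations q \<union> rotations (reverse_quad q))"
      using i(3) by auto
  qed
qed

text \<open>The set Q contains one square for each pair of consecutive rungs, in the fixed direction.\<close>

definition normal_form :: "nat \<Rightarrow> vertex diagram \<Rightarrow> vertex quad set \<Rightarrow> bool" where
  "normal_form n D Q \<longleftrightarrow> ladder D \<and> Q \<subseteq> induced_squares D \<and>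
     Q \<in> {{square1}, {square1, square2}, {square1, square2, square3}} \<and>
     (\<forall>i. rung D i \<longrightarrow> rung D (i + 1) \<longrightarrow>
        i = 0 \<or> i = 1 \<and> square2 \<in> Q \<or> i = 2 \<and> square3 \<in> Q) \<and>
     square_group D Q \<cong> square_group (coxeter_E n) {}"

lemma ladder_carter:
  "ladder E6_a1" "ladder E6_a2" "ladder E7_a1" "ladder E7_a2" "ladder E7_a3" "ladder E8_a1"
  "ladder E8_a2" "ladder E8_a3" "ladder E8_a4" "ladder E8_a5" "ladder E8_a6"
  by (auto simp: ladder_def edges_carter)

lemma rung_carter:
  "rung E6_a1 i \<longleftrightarrow> i = 0 \<or> i = 1"
  "rung E6_a2 i \<longleftrightarrow> i = 0 \<or> i = 1 \<or> i = 2"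
  "rung E7_a1 i \<longleftrightarrow> i = 0 \<or> i = 1"
  "rung E7_a2 i \<longleftrightarrow> i = 0 \<or> i = 1"
  "rung E7_a3 i \<longleftrightarrow> i = 0 \<or> i = 1 \<or> i = 2"
  "rung E8_a1 i \<longleftrightarrow> i = 0 \<or> i = 1"
  "rung E8_a2 i \<longleftrightarrow> i = 0 \<or> i = 1"
  "rung E8_a3 i \<longleftrightarrow> i = 0 \<or> i = 1"
  "rung E8_a4 i \<longleftrightarrow> i = 0 \<or> i = 1 \<or> i = 2"
  "rung E8_a5 i \<longleftrightarrow> i = 0 \<or> i = 1 \<or> i = 2"
  "rung E8_a6 i \<longleftrightarrow> i = 0 \<or> i = 1 \<or> i = 2 \<or> i = 3"
  by (auto simp: rung_def edges_carter doubleton_eq_iff)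

lemma carter_E_normal_form:
  assumes "D \<in> carter_E n"
  shows "\<exists>Q. normal_form n D Q"
proof -
  note simps = normal_form_def ladder_carter rung_carter induced_squares_def verts_carter edges_carter
    doubleton_eq_iff
  have "normal_form 6 E6_a1 {square1}"
    by (auto simp: simps E6_a1_iso)
  moreover have "normal_form 6 E6_a2 {square1, square2}"
    by (auto simp: simps E6_a2_iso)
  moreover have "normal_form 7 E7_a1 {square1}"
    by (auto simp: simps E7_a1_iso)
  moreover have "normal_form 7 E7_a2 {square1}"
    by (auto simp: simps E7_a2_iso)
  moreover have "normal_form 7 E7_a3 {square1, square2}"
    by (auto simp: simps E7_a3_iso)
  moreover have "normal_form 8 E8_a1 {square1}"
    by (auto simp: simps E8_a1_iso)
  moreover have "normal_form 8 E8_a2 {square1}"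
    by (auto simp: simps E8_a2_iso)
  moreover have "normal_form 8 E8_a3 {square1}"
    by (auto simp: simps E8_a3_iso)
  moreover have "normal_form 8 E8_a4 {square1, square2}"
    by (auto simp: simps E8_a4_iso)
  moreover have "normal_form 8 E8_a5 {square1, square2}"
    by (auto simp: simps E8_a5_iso)
  moreover have "normal_form 8 E8_a6 {square1, square2, square3}"
    by (auto simp: simps E8_a6_iso)
  ultimately show ?thesis
    using assms unfolding carter_E_def by (auto split: if_splits)
qed

theorem theorem2p19:
  fixes n :: nat and D :: "vertex diagram"
    and A :: "(vertex \<times> vertex) set" and T :: "vertex quad set"
  assumes "n \<in> {6, 7, 8}"
    and "D \<in> carter_E n"
    and "is_orientation D A"
    and "four_cycles_oriented D A"
    and "is_cycle_transversal A T"
  shows "presented_group (verts D) (braid_relations D \<union> cc_relations T) \<cong> artin_group (coxeter_E n)"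
proof -
  obtain Q where Q: "normal_form n D Q"
    using carter_E_normal_form[OF assms(2)] by blast
  then have "square_group D T \<cong> square_group D Q"
    using assms(3-5) by (intro ladder_oriented) (auto simp: normal_form_def)
  then have "square_group D T \<cong> square_group (coxeter_E n) {}"
    using Q by (auto simp: normal_form_def intro: iso_trans)
  then show ?thesis
    unfolding artin_group_eq_square_group by (simp add: square_group_def)
qed

end
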